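(* Let $\mu$ be the Gaussian measure on $\mathbb{R}^n$ or the exponential measure on $\mathbb{R}^n_+$ (see context), with moments $y_\alpha=\int\mathbf{x}^\alpha\,d\mu$. Let $\Omega=\{\mathbf{x}\in\mathbb{R}^n:g_j(\mathbf{x})\ge0,\ j=1,\dots,m\}$ with $g_j\in\mathbb{R}[\mathbf{x}]$; when $\mu$ is the exponential measure the constraints $x_i\ge0$, $i=1,\dots,n$, are among the constraints $g_j\ge0$. Let $\Omega^c=\operatorname{supp}\mu\setminus\Omega$, and let $\Omega^c_\ell=\{\mathbf{x}:g_{\ell j}(\mathbf{x})\ge0,\ j=1,\dots,m_\ell\}\subseteq\operatorname{supp}\mu$, $\ell=1,\dots,s$, $g_{\ell j}\in\mathbb{R}[\mathbf{x}]$, be such that $\Omega^c=\bigcup_{\ell=1}^s\Omega^c_\ell$ up to a set of $\mu$-measure zero, with pairwise overlaps of $\mu$-measure zero. For a finite family $G$ of polynomials, $h\in\mathbb{R}[\mathbf{x}]$ and $d$ with $2d\ge\deg h$ and $d\ge\lceil\deg(g)/2\rceil$ for all $g\in G$, let $$\overline{o}_d(h;G)=\sup_{\mathbf{u},\mathbf{v}}\Big\{L_{\mathbf{u}}(h):u_\alpha+v_\alpha=y_\alpha\ \forall\alpha\in\mathbb{N}^n_{2d};\ \mathbf{M}_d(\mathbf{u})\succeq0,\ \mathbf{M}_d(\mathbf{v})\succeq0;\ \mathbf{M}_{d-\lceil\deg(g)/2\rceil}(g\,\mathbf{u})\succeq0\ \forall g\in G\Big\}$$ over $\mathbf{u}=(u_\alpha)_{\alpha\in\mathbb{N}^n_{2d}}$,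 $\mathbf{v}=(v_\alpha)_{\alpha\in\mathbb{N}^n_{2d}}$. Let $d_0$ be the maximum of $\lceil\deg(g)/2\rceil$ over all $g\in\{g_j\}\cup\{g_{\ell j}\}$. (1) With $\overline{o}_d=\overline{o}_d(1;\{g_j\}_{j})$ and $\underline{o}_d=\mu(\mathbb{R}^n)-\sum_{\ell=1}^s\overline{o}_d(1;\{g_{\ell j}\}_{j})$, $$\underline{o}_d\le\mu(\Omega)\le\overline{o}_d\quad\forall d\ge d_0,\qquad\text{and}\qquad\lim_{d\to\infty}\underline{o}_d=\mu(\Omega)=\lim_{d\to\infty}\overline{o}_d.$$ (2) Let $f\in\mathbb{R}[\mathbf{x}]$ vanish on the boundary $\partial\Omega$. With $\overline{o}_d=\overline{o}_d(f^2;\{g_j\}_j)$ and $\underline{o}_d=\int f^2\,d\mu-\sum_{\ell=1}^s\overline{o}_d(f^2;\{g_{\ell j}\}_j)$, $$\underline{o}_d\le\int_\Omega f^2\,d\mu\le\overline{o}_d\quad\forall d\ge d_0\text{ with }d\ge\deg f,\qquad\text{and}\qquad\lim_{d\to\infty}\underline{o}_d=\int_\Omega f^2\,d\mu=\lim_{d\to\infty}\overline{o}_d.$$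
   Context: Measures: the Gaussian measure is $\mu(B)=(2\pi)^{-n/2}\int_B\exp(-\|\mathbf{x}\|^2/2)\,d\mathbf{x}$ for Borel $B\subseteq\mathbb{R}^n$ (support $\mathbb{R}^n$); the exponential measure is $\mu(B)=(2\pi)^{-n/2}\int_B\exp(-\sum_{i=1}^n x_i)\,d\mathbf{x}$ for Borel $B\subseteq\mathbb{R}^n_+$, viewed as a measure on $\mathbb{R}^n$ with support $\mathbb{R}^n_+=\{\mathbf{x}:\mathbf{x}\ge0\}$. Notation: $\mathbb{N}^n_k=\{\alpha\in\mathbb{N}^n:\sum_i\alpha_i\le k\}$. For a (truncated) sequence $\mathbf{z}=(z_\alpha)$, $L_{\mathbf{z}}(\sum_\alpha f_\alpha\mathbf{x}^\alpha)=\sum_\alpha f_\alpha z_\alpha$. The moment matrix $\mathbf{M}_k(\mathbf{z})$ has rows and columns indexed by $\mathbb{N}^n_k$ and $(\alpha,\beta)$ entry $z_{\alpha+\beta}$; for $g=\sum_\gamma g_\gamma\mathbf{x}^\gamma$ the localizing matrix $\mathbf{M}_k(g\,\mathbf{z})$ has rows and columns indexed by $\mathbb{N}^n_k$ and $(\alpha,\beta)$ entry $\sum_\gamma g_\gamma z_{\alpha+\beta+\gamma}$. $\mathbf{A}\succeq0$ means the real symmetric matrix $\mathbf{A}$ is positive semidefinite. *)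

theory Defs
  imports "HOL-Analysis.Analysis" "HOL-Library.Poly_Mapping"
begin

text \<open>The type \<open>'n\<close> indexes the variables, so that \<open>\<real>\<^sup>n\<close> is \<open>real ^ 'n\<close>, multi-indices are
  finitely supported maps \<open>'n \<Rightarrow>\<^sub>0 nat\<close>, and a polynomial is its finitely supported family of
  coefficients; the product of \<open>\<Rightarrow>\<^sub>0\<close> is convolution, hence multiplication of polynomials.\<close>

type_synonym 'n mindex = "'n \<Rightarrow>\<^sub>0 nat"
type_synonym 'n rpoly = "('n \<Rightarrow>\<^sub>0 nat) \<Rightarrow>\<^sub>0 real"

definition mindex_deg :: "'n::finite mindex \<Rightarrow> nat" where
  "mindex_deg \<alpha> = (\<Sum>i\<in>UNIV. Poly_Mapping.lookup \<alpha> i)"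

definition mindices :: "nat \<Rightarrow> 'n::finite mindex set" where
  "mindices k = {\<alpha>. mindex_deg \<alpha> \<le> k}"

definition monom_eval :: "'n::finite mindex \<Rightarrow> real ^ 'n \<Rightarrow> real" where
  "monom_eval \<alpha> x = (\<Prod>i\<in>UNIV. (x $ i) ^ Poly_Mapping.lookup \<alpha> i)"

definition poly_eval :: "'n::finite rpoly \<Rightarrow> real ^ 'n \<Rightarrow> real" where
  "poly_eval p x = (\<Sum>\<alpha>\<in>Poly_Mapping.keys p. Poly_Mapping.lookup p \<alpha> * monom_eval \<alpha> x)"

text \<open>Total degree, with the convention that the zero polynomial has degree 0.\<close>

definition poly_deg :: "'n::finite rpoly \<Rightarrow> nat" where
  "poly_deg p = Max (insert 0 (mindex_deg ` Poly_Mapping.keys p))"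

definition half_deg :: "'n::finite rpoly \<Rightarrow> nat" where
  "half_deg p = nat \<lceil>real (poly_deg p) / 2\<rceil>"

definition poly_var :: "'n::finite \<Rightarrow> 'n rpoly" where
  "poly_var i = Poly_Mapping.single (Poly_Mapping.single i 1) 1"

definition semialg :: "'n::finite rpoly set \<Rightarrow> (real ^ 'n) set" where
  "semialg G = {x. \<forall>g\<in>G. 0 \<le> poly_eval g x}"

definition gaussian_measure :: "(real ^ 'n::finite) measure" where
  "gaussian_measure = density lborel
     (\<lambda>x. ennreal ((2 * pi) powr (- real CARD('n) / 2) * exp (- (norm x)\<^sup>2 / 2)))"

text \<open>The normalising constant of the exponential measure is the same as in the Gaussian case;
  in particular this is not a probability measure.\<close>

definition exponential_measure :: "(real ^ 'n::finite) measure" where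
  "exponential_measure = density lborel
     (\<lambda>x. ennreal ((2 * pi) powr (- real CARD('n) / 2) * exp (- (\<Sum>i\<in>UNIV. x $ i)))
          * indicator {x. \<forall>i. 0 \<le> x $ i} x)"

definition measure_supp :: "'a::topological_space measure \<Rightarrow> 'a set" where
  "measure_supp M = {x. \<forall>U. open U \<longrightarrow> x \<in> U \<longrightarrow> 0 < emeasure M U}"

definition moment :: "(real ^ 'n::finite) measure \<Rightarrow> 'n mindex \<Rightarrow> real" where
  "moment M \<alpha> = (LINT x|M. monom_eval \<alpha> x)"

definition riesz :: "('n::finite mindex \<Rightarrow> real) \<Rightarrow> 'n rpoly \<Rightarrow> real" where
  "riesz z p = (\<Sum>\<alpha>\<in>Poly_Mapping.keys p. Poly_Mapping.lookup p \<alpha> * z \<alpha>)"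

definition moment_matrix ::
    "('n::finite mindex \<Rightarrow> real) \<Rightarrow> 'n mindex \<Rightarrow> 'n mindex \<Rightarrow> real" where
  "moment_matrix z \<alpha> \<beta> = z (\<alpha> + \<beta>)"

definition localizing_matrix ::
    "'n::finite rpoly \<Rightarrow> ('n mindex \<Rightarrow> real) \<Rightarrow> 'n mindex \<Rightarrow> 'n mindex \<Rightarrow> real" where
  "localizing_matrix g z \<alpha> \<beta> =
     (\<Sum>\<gamma>\<in>Poly_Mapping.keys g. Poly_Mapping.lookup g \<gamma> * z (\<alpha> + \<beta> + \<gamma>))"

text \<open>Positive semidefiniteness of the real matrix with rows and columns indexed by \<open>I\<close>;
  the order \<open>k\<close> of a moment or localizing matrix enters through \<open>I = mindices k\<close>.\<close>

definition psd_on :: "'i set \<Rightarrow> ('i \<Rightarrow> 'i \<Rightarrow> real) \<Rightarrow> bool" where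
  "psd_on I A \<longleftrightarrow>
     (\<forall>\<alpha>\<in>I. \<forall>\<beta>\<in>I. A \<alpha> \<beta> = A \<beta> \<alpha>) \<and>
     (\<forall>c. 0 \<le> (\<Sum>\<alpha>\<in>I. \<Sum>\<beta>\<in>I. c \<alpha> * A \<alpha> \<beta> * c \<beta>))"

text \<open>The truncated sequences are represented by total functions. If \<open>half_deg g \<le> d\<close> for all
  \<open>g \<in> G\<close> and \<open>poly_deg h \<le> 2 * d\<close>, then only the values on \<open>mindices (2 * d)\<close> matter.\<close>

definition sdp_feasible ::
    "(real ^ 'n::finite) measure \<Rightarrow> nat \<Rightarrow> 'n rpoly set \<Rightarrow>
     ('n mindex \<Rightarrow> real) \<Rightarrow> ('n mindex \<Rightarrow> real) \<Rightarrow> bool" where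
  "sdp_feasible M d G u v \<longleftrightarrow>
     (\<forall>\<alpha>\<in>mindices (2 * d). u \<alpha> + v \<alpha> = moment M \<alpha>) \<and>
     psd_on (mindices d) (moment_matrix u) \<and>
     psd_on (mindices d) (moment_matrix v) \<and>
     (\<forall>g\<in>G. psd_on (mindices (d - half_deg g)) (localizing_matrix g u))"

definition sdp_sup ::
    "(real ^ 'n::finite) measure \<Rightarrow> nat \<Rightarrow> 'n rpoly \<Rightarrow> 'n rpoly set \<Rightarrow> ereal" where
  "sdp_sup M d h G = Sup {ereal (riesz u h) | u v. sdp_feasible M d G u v}"

lemma measure_supp_gaussian: "measure_supp gaussian_measure = (UNIV :: (real ^ 'n::finite) set)"
proof -
  have "0 < emeasure gaussian_measure U" if U: "open U" "x \<in> U" for U and x :: "real ^ 'n"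
  proof (rule ccontr)
    assume "\<not> ?thesis"
    then have "U \<in> null_sets (gaussian_measure :: (real ^ 'n) measure)"
      using U by (auto simp: null_sets_def gaussian_measure_def)
    then have "AE x in lborel. x \<in> U \<longrightarrow>
        ennreal ((2 * pi) powr (- real CARD('n) / 2) * exp (- (norm x)\<^sup>2 / 2)) = 0"
      unfolding gaussian_measure_def by (subst (asm) null_sets_density_iff) auto
    then have "AE x in lborel. x \<notin> U"
      by eventually_elim (auto simp: ennreal_eq_0_iff mult_le_0_iff)
    then have "U \<in> null_sets lborel"
      using U by (subst AE_iff_null_sets) auto
    then show False
      using U open_not_negligible[of U] null_sets_completionI[of U lborel]
      by (auto simp: negligible_iff_null_sets)
  qed
  then show ?thesis
    by (auto simp: measure_supp_def)
qed

lemma measure_supp_exponential: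
  "measure_supp exponential_measure = {x :: real ^ 'n::finite. \<forall>i. 0 \<le> x $ i}"
proof -
  let ?P = "{x :: real ^ 'n. \<forall>i. 0 \<le> x $ i}"
  let ?f = "\<lambda>x :: real ^ 'n.
    ennreal ((2 * pi) powr (- real CARD('n) / 2) * exp (- (\<Sum>i\<in>UNIV. x $ i))) * indicator ?P x"
  have P: "closed ?P"
    by (intro closed_Collect_all closed_Collect_le continuous_intros)
  have f [measurable]: "?f \<in> borel_measurable borel"
    using P by (intro borel_measurable_times_ennreal borel_measurable_indicator
      measurable_compose[OF _ measurable_ennreal] borel_measurable_continuous_onI continuous_intros) auto
  have "0 < emeasure exponential_measure U" if U: "open U" "x \<in> U" "x \<in> ?P" for U and x :: "real ^ 'n"
  proof (rule ccontr)
    let ?Q = "{x :: real ^ 'n. \<forall>i. 0 < x $ i}"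
    assume "\<not> ?thesis"
    then have "U \<in> null_sets (exponential_measure :: (real ^ 'n) measure)"
      using U by (auto simp: null_sets_def exponential_measure_def)
    then have "AE x in lborel. x \<in> U \<longrightarrow> ?f x = 0"
      unfolding exponential_measure_def using f by (subst (asm) null_sets_density_iff) auto
    then have "AE x in lborel. x \<notin> U \<inter> ?Q"
    proof eventually_elim
      case (elim x)
      have "?f x \<noteq> 0" if "x \<in> ?Q"
      proof -
        have "x \<in> ?P" using that by (auto intro: less_imp_le)
        then show ?thesis by (simp add: ennreal_eq_0_iff mult_le_0_iff)
      qed
      then show ?case using elim by blast
    qed
    moreover have "?Q = (\<Inter>i. {x. 0 < x $ i})"
      by auto
    then have Q: "open (U \<inter> ?Q)"
      using U(1) by (auto intro!: open_Int open_INT open_Collect_less continuous_intros)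
    ultimately have "U \<inter> ?Q \<in> null_sets lborel"
      by (subst AE_iff_null_sets) auto
    then have "negligible (U \<inter> ?Q)"
      using null_sets_completionI[of "U \<inter> ?Q" lborel] by (auto simp: negligible_iff_null_sets)
    moreover have "((\<lambda>t. x + t *\<^sub>R 1) \<longlongrightarrow> x + 0 *\<^sub>R 1) (at_right (0::real))"
      by (intro tendsto_intros)
    then have "eventually (\<lambda>t. x + t *\<^sub>R 1 \<in> U) (at_right (0::real))"
      using U topological_tendstoD by fastforce
    then have "eventually (\<lambda>t. x + t *\<^sub>R 1 \<in> U \<and> 0 < t) (at_right (0::real))"
      using eventually_at_right_less by (rule eventually_conj)
    then obtain t :: real where "x + t *\<^sub>R 1 \<in> U" "0 < t"
      using eventually_happens'[OF trivial_limit_at_right_real] by blast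
    then have "x + t *\<^sub>R 1 \<in> U \<inter> ?Q"
      using U(3) by (auto intro: add_nonneg_pos)
    ultimately show False
      using open_not_negligible Q by blast
  qed
  moreover have "x \<notin> measure_supp exponential_measure" if "x \<notin> ?P" for x
  proof -
    have "emeasure exponential_measure (- ?P) = (\<integral>\<^sup>+x. ?f x * indicator (- ?P) x \<partial>lborel)"
      unfolding exponential_measure_def using P f by (intro emeasure_density) auto
    also have "\<dots> = (\<integral>\<^sup>+(x::real^'n). 0 \<partial>lborel)"
      by (intro nn_integral_cong) (auto simp: indicator_def)
    finally show ?thesis
      using P that unfolding measure_supp_def by (auto intro!: exI[of _ "- ?P"])
  qed
  ultimately show ?thesis
    unfolding measure_supp_def by blast
qed

end

theory Submission imports Defs begin

text \<open>The lower bound on the optimal values is witnessed by the moments of \<open>\<mu>\<close> restricted to the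
  semialgebraic set. For the limit we exhibit approximate dual certificates. With
  \<open>P = (\<Sum>g. (max 0 (- g))\<^sup>2)\<close>, the bounded continuous functions \<open>t\<^sub>0 = (1 + k P)\<^bsup>-1/2\<^esup>\<close> and
  \<open>t\<^sub>g = (k max 0 (- g) / (1 + k P))\<^bsup>1/2\<^esup>\<close> satisfy \<open>1 = t\<^sub>0\<^sup>2 - (\<Sum>g. g t\<^sub>g\<^sup>2)\<close>, and
  \<open>t\<^sub>0\<^sup>2\<close> decreases to the indicator of the set as \<open>k\<close> grows. Since \<open>\<mu>\<close> has exponential
  moments, these functions are limits of polynomials \<open>q\<^sub>0\<close>, \<open>q\<^sub>g\<close> in polynomially weighted
  \<open>L\<^sup>4\<close>, so that \<open>W = f\<^sup>2 (1 - q\<^sub>0\<^sup>2 + (\<Sum>g. g q\<^sub>g\<^sup>2))\<close> is small in \<open>L\<^sup>2(\<mu>)\<close>. A feasible functional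
  \<open>L\<close> of sufficiently high order satisfies \<open>L(p\<^sup>2) \<le> \<integral>p\<^sup>2 d\<mu>\<close>, hence \<open>L(W)\<close> is small, and
  \<open>L(g (f q\<^sub>g)\<^sup>2) \<ge> 0\<close>; therefore \<open>L(f\<^sup>2) \<le> L(W) + \<integral>f\<^sup>2 q\<^sub>0\<^sup>2 d\<mu>\<close>, which is close to the integral
  of \<open>f\<^sup>2\<close> over the set. No compactness or representation theorem for moment sequences is needed,
  and volumes are the case \<open>f = 1\<close>.\<close>

section \<open>Riesz functionals and positive semidefiniteness\<close>

lemma riesz_eq_sum_superset:
  assumes "finite S" "Poly_Mapping.keys p \<subseteq> S"
  shows "riesz u p = (\<Sum>\<alpha>\<in>S. Poly_Mapping.lookup p \<alpha> * u \<alpha>)"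
  unfolding riesz_def using assms
  by (intro sum.mono_neutral_left) (auto simp: in_keys_iff)

lemma riesz_add: "riesz u (p + q) = riesz u p + riesz u q"
proof -
  let ?S = "Poly_Mapping.keys p \<union> Poly_Mapping.keys q"
  have "finite ?S" by simp
  then show ?thesis
    using riesz_eq_sum_superset[of ?S p u] riesz_eq_sum_superset[of ?S q u]
      riesz_eq_sum_superset[of ?S "p + q" u] keys_add[of p q]
    by (simp add: lookup_add sum.distrib distrib_right)
qed

lemma riesz_zero: "riesz u 0 = 0"
  by (simp add: riesz_def)

lemma riesz_diff: "riesz u (p - q) = riesz u p - riesz u q"
  using riesz_add[of u "p - q" q] by simp

lemma riesz_sum: "riesz u (\<Sum>i\<in>I. p i) = (\<Sum>i\<in>I. riesz u (p i))"
  by (induction I rule: infinite_finite_induct) (simp_all add: riesz_zero riesz_add)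

lemma riesz_single: "riesz u (Poly_Mapping.single \<alpha> c) = c * u \<alpha>"
  by (simp add: riesz_def)

lemma riesz_one: "riesz u 1 = u 0"
  using riesz_single[of u 0 1] by simp

lemma riesz_cong: "(\<And>\<alpha>. \<alpha> \<in> Poly_Mapping.keys p \<Longrightarrow> u \<alpha> = v \<alpha>) \<Longrightarrow> riesz u p = riesz v p"
  by (simp add: riesz_def)

lemma riesz_add_functional: "riesz (\<lambda>\<alpha>. u \<alpha> + v \<alpha>) p = riesz u p + riesz v p"
  by (simp add: riesz_def sum.distrib distrib_left)

lemma poly_mapping_eq_sum_single:
  fixes p :: "'a \<Rightarrow>\<^sub>0 'b::comm_monoid_add"
  shows "p = (\<Sum>\<alpha>\<in>Poly_Mapping.keys p. Poly_Mapping.single \<alpha> (Poly_Mapping.lookup p \<alpha>))"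
proof (rule poly_mapping_eqI)
  fix \<beta>
  show "Poly_Mapping.lookup p \<beta> = Poly_Mapping.lookup
      (\<Sum>\<alpha>\<in>Poly_Mapping.keys p. Poly_Mapping.single \<alpha> (Poly_Mapping.lookup p \<alpha>)) \<beta>"
    by (cases "\<beta> \<in> Poly_Mapping.keys p")
      (auto simp: lookup_sum lookup_single when_def sum.delta in_keys_iff)
qed

text \<open>Iterating the functional over the two factors exposes the entries
  \<open>u (\<alpha> + \<beta>)\<close> of the moment matrix. The same formula makes point
  evaluation multiplicative.\<close>

lemma riesz_mult: "riesz u (p * q) = riesz (\<lambda>\<alpha>. riesz (\<lambda>\<beta>. u (\<alpha> + \<beta>)) q) p"
proof -
  have "p * q = (\<Sum>\<alpha>\<in>Poly_Mapping.keys p. \<Sum>\<beta>\<in>Poly_Mapping.keys q.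
      Poly_Mapping.single (\<alpha> + \<beta>) (Poly_Mapping.lookup p \<alpha> * Poly_Mapping.lookup q \<beta>))"
    by (subst poly_mapping_eq_sum_single[of p], subst poly_mapping_eq_sum_single[of q])
      (simp add: sum_product mult_single)
  then show ?thesis
    by (simp add: riesz_sum riesz_single) (simp add: riesz_def sum_distrib_left mult.assoc)
qed

section \<open>Evaluation of polynomials at points\<close>

text \<open>Evaluation at a point is the Riesz functional of the Dirac measure there, so its
  algebraic laws are inherited from those of \<open>riesz\<close>.\<close>

lemma poly_eval_eq_riesz: "poly_eval p x = riesz (\<lambda>\<alpha>. monom_eval \<alpha> x) p"
  by (simp add: poly_eval_def riesz_def)

lemma monom_eval_add: "monom_eval (\<alpha> + \<beta>) x = monom_eval \<alpha> x * monom_eval \<beta> x"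
  by (simp add: monom_eval_def lookup_add power_add prod.distrib)

lemma monom_eval_zero: "monom_eval 0 x = 1"
  by (simp add: monom_eval_def)

lemma monom_eval_single: "monom_eval (Poly_Mapping.single i k) x = (x $ i) ^ k"
proof -
  have "monom_eval (Poly_Mapping.single i k) x = (\<Prod>j\<in>UNIV. if j = i then (x $ i) ^ k else 1)"
    unfolding monom_eval_def by (intro prod.cong) (auto simp: lookup_single when_def)
  then show ?thesis by simp
qed

lemma riesz_scale: "riesz (\<lambda>\<alpha>. c * u \<alpha>) p = c * riesz u p"
  by (simp add: riesz_def sum_distrib_left algebra_simps)

lemma poly_eval_add [simp]: "poly_eval (p + q) x = poly_eval p x + poly_eval q x"
  and poly_eval_diff [simp]: "poly_eval (p - q) x = poly_eval p x - poly_eval q x"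
  and poly_eval_sum [simp]: "poly_eval (\<Sum>i\<in>I. r i) x = (\<Sum>i\<in>I. poly_eval (r i) x)"
  and poly_eval_one [simp]: "poly_eval 1 x = 1"
  and poly_eval_single: "poly_eval (Poly_Mapping.single \<alpha> c) x = c * monom_eval \<alpha> x"
  by (simp_all add: poly_eval_eq_riesz riesz_add riesz_diff riesz_sum riesz_one monom_eval_zero
    riesz_single)

lemma poly_eval_mult [simp]: "poly_eval (p * q) x = poly_eval p x * poly_eval q x"
  by (simp add: poly_eval_eq_riesz riesz_mult monom_eval_add riesz_scale)
    (simp add: riesz_def sum_distrib_right mult.assoc)

lemma poly_eval_power [simp]: "poly_eval (p ^ k) x = poly_eval p x ^ k"
  by (induction k) simp_all

lemma poly_eval_const [simp]: "poly_eval (Poly_Mapping.single 0 c) x = c"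
  by (simp add: poly_eval_single monom_eval_zero)

text \<open>The matrix conditions sum over \<open>mindices k\<close>. A sum over an infinite set
  would default to 0, so finiteness is what gives these conditions their content.\<close>

lemma finite_mindices: "finite (mindices k :: 'n::finite mindex set)"
proof -
  have le: "Poly_Mapping.lookup \<alpha> i \<le> mindex_deg \<alpha>" for \<alpha> :: "'n mindex" and i
    unfolding mindex_deg_def by (rule member_le_sum) auto
  then have "Poly_Mapping.lookup ` mindices k \<subseteq> PiE UNIV (\<lambda>_::'n. {..k})"
    by (fastforce simp: mindices_def PiE_iff intro: order_trans)
  then have "finite (Poly_Mapping.lookup ` (mindices k :: 'n mindex set))"
    by (rule finite_subset) (auto intro: finite_PiE)
  then show ?thesis
    by (rule finite_imageD) (auto simp: inj_on_def)
qed

lemma keys_subset_mindices: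
  assumes "poly_deg p \<le> k"
  shows "Poly_Mapping.keys p \<subseteq> mindices k"
proof
  fix \<alpha> assume "\<alpha> \<in> Poly_Mapping.keys p"
  then have "mindex_deg \<alpha> \<le> poly_deg p"
    unfolding poly_deg_def by (intro Max_ge) auto
  then show "\<alpha> \<in> mindices k"
    using assms by (simp add: mindices_def)
qed

section \<open>Semidefiniteness tested on squares of polynomials\<close>

text \<open>The coefficients of \<open>q\<close>, extended by 0 to all of \<open>mindices k\<close>,
  form the test vector for the quadratic form of \<open>A\<close>.\<close>

lemma psd_on_riesz_nonneg:
  assumes "psd_on (mindices k) A" "poly_deg q \<le> k"
  shows "0 \<le> riesz (\<lambda>\<alpha>. riesz (A \<alpha>) q) q"
proof -
  note * = riesz_eq_sum_superset[OF finite_mindices keys_subset_mindices[OF assms(2)]]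
  have "riesz (\<lambda>\<alpha>. riesz (A \<alpha>) q) q = (\<Sum>\<alpha>\<in>mindices k. \<Sum>\<beta>\<in>mindices k.
      Poly_Mapping.lookup q \<alpha> * A \<alpha> \<beta> * Poly_Mapping.lookup q \<beta>)"
    by (simp add: * sum_distrib_left mult_ac)
  then show ?thesis
    using assms(1) by (simp add: psd_on_def)
qed

lemma moment_matrix_psd_riesz_square:
  assumes "psd_on (mindices k) (moment_matrix u)" "poly_deg q \<le> k"
  shows "0 \<le> riesz u (q\<^sup>2)"
  using psd_on_riesz_nonneg[OF assms] by (simp add: power2_eq_square riesz_mult moment_matrix_def[abs_def])

lemma localizing_matrix_psd_riesz_square:
  assumes "psd_on (mindices k) (localizing_matrix g u)" "poly_deg q \<le> k"
  shows "0 \<le> riesz u (g * q\<^sup>2)"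
proof -
  \<comment> \<open>The factors are ordered so that unfolding the products from the left yields the
    nesting \<open>q\<close>, \<open>q\<close>, \<open>g\<close> of the localizing matrix.\<close>
  have "riesz u (g * q\<^sup>2) = riesz u (q * (q * g))"
    by (simp add: power2_eq_square mult_ac)
  also have "\<dots> = riesz (\<lambda>\<alpha>. riesz (localizing_matrix g u \<alpha>) q) q"
    by (simp add: riesz_mult localizing_matrix_def[abs_def] riesz_def[of _ g] add.assoc)
  finally show ?thesis
    using psd_on_riesz_nonneg[OF assms] by simp
qed

text \<open>The functional of \<open>v\<close> is nonnegative on squares, and \<open>u + v\<close>
  gives the moments. This domination carries mean-square estimates for the measure over to every
  feasible \<open>u\<close>.\<close>

lemma sdp_feasible_riesz_square_le:
  assumes "sdp_feasible M d G u v" "poly_deg q \<le> d"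
  shows "riesz u (q\<^sup>2) \<le> riesz (moment M) (q\<^sup>2)"
proof -
  have "0 \<le> riesz v (q\<^sup>2)"
    using assms by (auto simp: sdp_feasible_def intro: moment_matrix_psd_riesz_square)
  \<comment> \<open>Feasibility fixes \<open>u + v\<close> only up to degree \<open>2 * d\<close>;
    the exponents in \<open>q * q\<close> are sums of two exponents of degree at most
    \<open>d\<close>.\<close>
  moreover have "moment M (\<alpha> + \<beta>) = u (\<alpha> + \<beta>) + v (\<alpha> + \<beta>)"
    if "\<alpha> \<in> Poly_Mapping.keys q" "\<beta> \<in> Poly_Mapping.keys q" for \<alpha> \<beta>
  proof -
    have "\<alpha> \<in> mindices d" "\<beta> \<in> mindices d"
      using that keys_subset_mindices[OF assms(2)] by auto
    then have "\<alpha> + \<beta> \<in> mindices (2 * d)"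
      by (simp add: mindices_def mindex_deg_def lookup_add sum.distrib)
    then show ?thesis
      using assms(1) by (simp add: sdp_feasible_def)
  qed
  then have "riesz (moment M) (q\<^sup>2) = riesz (\<lambda>\<alpha>. u \<alpha> + v \<alpha>) (q\<^sup>2)"
    by (auto simp: power2_eq_square riesz_mult intro!: riesz_cong)
  ultimately show ?thesis
    by (simp add: riesz_add_functional)
qed

text \<open>The quadratic form with coefficients \<open>c\<close> is the integral of
  \<open>b\<close> times the square of the combination
  \<open>\<Sum>\<alpha>\<in>I. c \<alpha> * \<phi> \<alpha> x\<close>.\<close>

lemma psd_on_integral:
  fixes \<phi> :: "'i \<Rightarrow> 'a \<Rightarrow> real"
  assumes "\<And>\<alpha> \<beta>. integrable M (\<lambda>x. \<phi> \<alpha> x * \<phi> \<beta> x * b x)" "\<And>x. 0 \<le> b x"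
  shows "psd_on I (\<lambda>\<alpha> \<beta>. LINT x|M. \<phi> \<alpha> x * \<phi> \<beta> x * b x)"
proof -
  have "(\<Sum>\<alpha>\<in>I. \<Sum>\<beta>\<in>I. c \<alpha> * (LINT x|M. \<phi> \<alpha> x * \<phi> \<beta> x * b x) * c \<beta>)
      = (LINT x|M. (\<Sum>\<alpha>\<in>I. c \<alpha> * \<phi> \<alpha> x)\<^sup>2 * b x)" for c
  proof -
    have "(LINT x|M. (\<Sum>\<alpha>\<in>I. c \<alpha> * \<phi> \<alpha> x)\<^sup>2 * b x) =
        (LINT x|M. (\<Sum>\<alpha>\<in>I. \<Sum>\<beta>\<in>I. (c \<alpha> * c \<beta>) * (\<phi> \<alpha> x * \<phi> \<beta> x * b x)))"
      by (simp add: power2_eq_square sum_product sum_distrib_right sum_distrib_left mult_ac)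
    also have "\<dots> = (\<Sum>\<alpha>\<in>I. \<Sum>\<beta>\<in>I. (c \<alpha> * c \<beta>) * (LINT x|M. \<phi> \<alpha> x * \<phi> \<beta> x * b x))"
      using assms(1) by (simp add: Bochner_Integration.integral_sum)
    finally show ?thesis
      by (simp add: mult_ac)
  qed
  moreover have "0 \<le> (LINT x|M. (\<Sum>\<alpha>\<in>I. c \<alpha> * \<phi> \<alpha> x)\<^sup>2 * b x)" for c
    using assms(2) by (intro integral_nonneg_AE) auto
  ultimately show ?thesis
    by (simp add: psd_on_def mult.commute)
qed

section \<open>Functions of subexponential growth\<close>

abbreviation l1_norm :: "real ^ 'n::finite \<Rightarrow> real" where
  "l1_norm x \<equiv> \<Sum>i\<in>UNIV. \<bar>x $ i\<bar>"

text \<open>A bound at every rate \<open>b > 0\<close> makes the class closed under products, since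
  each factor can take half the rate. Polynomials and bounded Borel functions belong to it, and a
  single exponential moment makes all its members integrable.\<close>

definition subexp :: "(real ^ 'n::finite \<Rightarrow> real) \<Rightarrow> bool" where
  "subexp h \<longleftrightarrow> h \<in> borel_measurable borel \<and>
     (\<forall>b>0. \<exists>C. \<forall>x. \<bar>h x\<bar> \<le> C * exp (b * l1_norm x))"

lemma subexp_measurable: "subexp h \<Longrightarrow> h \<in> borel_measurable borel"
  by (simp add: subexp_def)

lemma subexp_bounded:
  assumes "h \<in> borel_measurable borel" "\<And>x. \<bar>h x\<bar> \<le> C"
  shows "subexp h"
proof -
  have "\<bar>h x\<bar> \<le> C * exp (b * l1_norm x)" if "b > 0" for b x
  proof -
    have "\<bar>h x\<bar> * 1 \<le> C * exp (b * l1_norm x)"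
      using assms(2)[of x] that by (intro mult_mono) (auto intro: sum_nonneg)
    then show ?thesis by simp
  qed
  then show ?thesis
    using assms(1) unfolding subexp_def by blast
qed

lemma subexp_const: "subexp (\<lambda>x. c)"
  by (rule subexp_bounded[where C = "\<bar>c\<bar>"]) auto

lemma subexp_add:
  assumes "subexp h" "subexp k"
  shows "subexp (\<lambda>x. h x + k x)"
  unfolding subexp_def
proof (intro conjI allI impI)
  show "(\<lambda>x. h x + k x) \<in> borel_measurable borel"
    using assms by (auto simp: subexp_def)
  fix b :: real assume "b > 0"
  then obtain C D where C: "\<And>x. \<bar>h x\<bar> \<le> C * exp (b * l1_norm x)"
    and D: "\<And>x. \<bar>k x\<bar> \<le> D * exp (b * l1_norm x)"
    using assms unfolding subexp_def by metis
  have "\<bar>h x + k x\<bar> \<le> (C + D) * exp (b * l1_norm x)" for x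
    using abs_triangle_ineq[of "h x" "k x"] C[of x] D[of x] unfolding distrib_right by linarith
  then show "\<exists>C. \<forall>x. \<bar>h x + k x\<bar> \<le> C * exp (b * l1_norm x)"
    by blast
qed

lemma subexp_mult:
  assumes "subexp h" "subexp k"
  shows "subexp (\<lambda>x. h x * k x)"
  unfolding subexp_def
proof (intro conjI allI impI)
  show "(\<lambda>x. h x * k x) \<in> borel_measurable borel"
    using assms by (auto simp: subexp_def)
  fix b :: real assume "b > 0"
  then have "b / 2 > 0" by simp
  then obtain C D where C: "\<And>x. \<bar>h x\<bar> \<le> C * exp (b / 2 * l1_norm x)"
    and D: "\<And>x. \<bar>k x\<bar> \<le> D * exp (b / 2 * l1_norm x)"
    using assms unfolding subexp_def by metis
  have "\<bar>h x * k x\<bar> \<le> (C * D) * exp (b * l1_norm x)" for x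
  proof -
    have "\<bar>h x * k x\<bar> \<le> (C * exp (b / 2 * l1_norm x)) * (D * exp (b / 2 * l1_norm x))"
      unfolding abs_mult using C[of x] D[of x] by (intro mult_mono) auto
    also have "exp (b * l1_norm x) = exp (b / 2 * l1_norm x) * exp (b / 2 * l1_norm x)"
      unfolding exp_add[symmetric] by simp
    then have "(C * exp (b / 2 * l1_norm x)) * (D * exp (b / 2 * l1_norm x))
        = (C * D) * exp (b * l1_norm x)"
      by (simp add: mult_ac)
    finally show ?thesis .
  qed
  then show "\<exists>C. \<forall>x. \<bar>h x * k x\<bar> \<le> C * exp (b * l1_norm x)"
    by blast
qed

lemma subexp_diff:
  assumes "subexp h" "subexp k"
  shows "subexp (\<lambda>x. h x - k x)"
  using subexp_add[OF assms(1) subexp_mult[OF subexp_const[of "-1"] assms(2)]] by simp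

lemma subexp_power: "subexp h \<Longrightarrow> subexp (\<lambda>x. h x ^ k)"
  by (induction k) (auto intro: subexp_const subexp_mult)

lemma subexp_sum: "(\<And>i. i \<in> I \<Longrightarrow> subexp (h i)) \<Longrightarrow> subexp (\<lambda>x. \<Sum>i\<in>I. h i x)"
  by (induction I rule: infinite_finite_induct) (auto intro: subexp_const subexp_add)

lemma subexp_prod: "(\<And>i. i \<in> I \<Longrightarrow> subexp (h i)) \<Longrightarrow> subexp (\<lambda>x. \<Prod>i\<in>I. h i x)"
  by (induction I rule: infinite_finite_induct) (auto intro: subexp_const subexp_mult)

lemma subexp_coordinate: "subexp (\<lambda>x. x $ i)"
  unfolding subexp_def
proof (intro conjI allI impI)
  show "(\<lambda>x. x $ i) \<in> borel_measurable borel"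
    by (intro borel_measurable_continuous_onI continuous_intros)
  fix b :: real assume b: "b > 0"
  \<comment> \<open>This is \<open>t \<le> exp t\<close> at
    \<open>t = b * l1_norm x\<close>.\<close>
  have "\<bar>x $ i\<bar> \<le> (1 / b) * exp (b * l1_norm x)" for x :: "real ^ 'a"
  proof -
    have "\<bar>x $ i\<bar> \<le> l1_norm x"
      by (rule member_le_sum) auto
    then have "b * \<bar>x $ i\<bar> \<le> b * l1_norm x"
      using b by simp
    also have "\<dots> \<le> exp (b * l1_norm x)"
      using exp_ge_add_one_self[of "b * l1_norm x"] by linarith
    finally show ?thesis
      using b by (simp add: field_simps)
  qed
  then show "\<exists>C. \<forall>x. \<bar>x $ i\<bar> \<le> C * exp (b * l1_norm x)"
    by blast
qed

lemma subexp_monom_eval: "subexp (monom_eval \<alpha>)"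
  unfolding monom_eval_def[abs_def] by (intro subexp_prod subexp_power subexp_coordinate)

lemma subexp_poly_eval: "subexp (poly_eval p)"
  unfolding poly_eval_def[abs_def] by (intro subexp_sum subexp_mult subexp_const subexp_monom_eval)

lemmas subexp_intros = subexp_const subexp_add subexp_mult subexp_diff subexp_power subexp_sum
  subexp_poly_eval subexp_monom_eval

lemma continuous_on_poly_eval: "continuous_on S (poly_eval p)"
  unfolding poly_eval_def[abs_def] monom_eval_def[abs_def] by (intro continuous_intros)

lemma closed_semialg: "closed (semialg G)"
proof -
  have "semialg G = (\<Inter>g\<in>G. {x. 0 \<le> poly_eval g x})"
    by (auto simp: semialg_def)
  then show ?thesis
    by (auto intro!: closed_INT closed_Collect_le continuous_intros continuous_on_poly_eval)
qed

text \<open>If \<open>q\<close> is close to a bounded \<open>t\<close> in this sense, then \<open>q\<^sup>2\<close> is close to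
  \<open>t\<^sup>2\<close> in mean square.\<close>

definition quad_quart :: "real \<Rightarrow> real" where
  "quad_quart x = x\<^sup>2 + x ^ 4"

lemma quad_quart_nonneg: "0 \<le> quad_quart x"
  by (simp add: quad_quart_def)

text \<open>Using \<open>(a + b)^2 \<le> 2 * (a^2 + b^2)\<close> twice costs a factor 8 in the
  fourth power. The result serves as a triangle inequality.\<close>

lemma quad_quart_add_le: "quad_quart (x + y) \<le> 8 * (quad_quart x + quad_quart y)"
proof -
  have *: "(a + b)\<^sup>2 \<le> 2 * (a\<^sup>2 + b\<^sup>2)" for a b :: real
    using zero_le_power2[of "a - b"] by (simp add: power2_eq_square algebra_simps)
  have "(x + y) ^ 4 = ((x + y)\<^sup>2)\<^sup>2" by simp
  also have "\<dots> \<le> (2 * (x\<^sup>2 + y\<^sup>2))\<^sup>2" by (intro power_mono *) simp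
  also have "\<dots> = 4 * (x\<^sup>2 + y\<^sup>2)\<^sup>2" by (simp only: power_mult_distrib) simp
  also have "\<dots> \<le> 4 * (2 * ((x\<^sup>2)\<^sup>2 + (y\<^sup>2)\<^sup>2))" by (intro mult_left_mono *) simp
  finally have "(x + y) ^ 4 \<le> 8 * (x ^ 4 + y ^ 4)" by simp
  moreover have "(x + y)\<^sup>2 \<le> 8 * (x\<^sup>2 + y\<^sup>2)"
    by (rule order_trans[OF *]) simp
  ultimately show ?thesis by (simp add: quad_quart_def)
qed

text \<open>The right-hand side expands into nonnegative terms, among them the two on the
  left.\<close>

lemma quad_quart_mult_le: "quad_quart (x * y) \<le> quad_quart x * quad_quart y"
  by (simp add: quad_quart_def power_mult_distrib algebra_simps)

lemma quad_quart_mono: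
  assumes "\<bar>x\<bar> \<le> C"
  shows "quad_quart x \<le> quad_quart C"
proof -
  have "\<bar>x\<bar> ^ 2 \<le> C ^ 2" "\<bar>x\<bar> ^ 4 \<le> C ^ 4"
    using power_mono[OF assms] by (simp_all only: abs_ge_zero)
  then show ?thesis by (simp add: quad_quart_def)
qed

text \<open>With \<open>d = q - t\<close>, the difference of squares is \<open>d * (q + t)\<close>,
  and \<open>q + t = 2 * t + d\<close>. The terms \<open>d^2\<close> and \<open>d^4\<close> that
  arise explain the shape of \<open>quad_quart\<close>.\<close>

lemma square_diff_le_quad_quart:
  assumes "\<bar>t\<bar> \<le> C"
  shows "(q\<^sup>2 - t\<^sup>2)\<^sup>2 \<le> (8 * C\<^sup>2 + 2) * quad_quart (q - t)"
proof -
  let ?d = "q - t"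
  have tC: "t\<^sup>2 \<le> C\<^sup>2"
    using assms by (metis abs_ge_zero power2_abs power_mono)
  have "(q + t)\<^sup>2 = (2 * t + ?d)\<^sup>2" by (simp add: algebra_simps)
  also have "\<dots> \<le> 8 * t\<^sup>2 + 2 * ?d\<^sup>2"
    using zero_le_power2[of "2 * t - ?d"] by (simp add: power2_eq_square algebra_simps)
  also have "\<dots> \<le> 8 * C\<^sup>2 + 2 * ?d\<^sup>2" using tC by simp
  finally have "?d\<^sup>2 * (q + t)\<^sup>2 \<le> ?d\<^sup>2 * (8 * C\<^sup>2 + 2 * ?d\<^sup>2)"
    by (rule mult_left_mono) simp
  also have "\<dots> = 8 * C\<^sup>2 * ?d\<^sup>2 + 2 * ?d ^ 4"
    by (simp add: distrib_left power2_eq_square power4_eq_xxxx)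
  also have "\<dots> \<le> (8 * C\<^sup>2 + 2) * quad_quart ?d"
    by (simp add: quad_quart_def distrib_left distrib_right)
  also have "?d\<^sup>2 * (q + t)\<^sup>2 = (q\<^sup>2 - t\<^sup>2)\<^sup>2"
    by (simp add: power2_eq_square algebra_simps)
  finally show ?thesis .
qed

lemma subexp_quad_quart: "subexp h \<Longrightarrow> subexp (\<lambda>x. quad_quart (h x))"
  unfolding quad_quart_def by (intro subexp_intros)

section \<open>A penalty function for semialgebraic sets\<close>

text \<open>The violations are squared because a constraint times its own negative part is minus the
  square of that part. A multiplier proportional to the negative part thus reproduces a summand of
  the penalty.\<close>

definition penalty :: "'n::finite rpoly set \<Rightarrow> real ^ 'n \<Rightarrow> real" where
  "penalty G x = (\<Sum>g\<in>G. (max 0 (- poly_eval g x))\<^sup>2)"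

lemma penalty_nonneg: "0 \<le> penalty G x"
  unfolding penalty_def by (intro sum_nonneg) simp

lemma penalty_eq_0_iff: "finite G \<Longrightarrow> penalty G x = 0 \<longleftrightarrow> x \<in> semialg G"
  unfolding penalty_def semialg_def by (subst sum_nonneg_eq_0_iff) (auto simp: max_def)

lemma continuous_on_penalty: "continuous_on S (penalty G)"
  unfolding penalty_def[abs_def] by (intro continuous_intros continuous_on_poly_eval)

section \<open>Polynomial approximation under exponential moments\<close>

text \<open>Both measures of the theorem satisfy this with \<open>a = 1/2\<close>, so convergence is
  proved once for the two.\<close>

locale exp_moments =
  fixes \<mu> :: "(real ^ 'n::finite) measure" and a :: real
  assumes sets_mu [measurable_cong]: "sets \<mu> = sets borel"
    and a_pos: "a > 0"
    and integrable_exp: "integrable \<mu> (\<lambda>x. exp (a * l1_norm x))"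
begin

lemma space_mu: "space \<mu> = UNIV"
  using sets_eq_imp_space_eq[OF sets_mu] by simp

lemma measurable_mu: "h \<in> borel_measurable borel \<Longrightarrow> h \<in> borel_measurable \<mu>"
  by (simp add: measurable_cong_sets[OF sets_mu refl])

lemma integrable_exp_bound:
  assumes "h \<in> borel_measurable borel" "\<And>x. \<bar>h x\<bar> \<le> C * exp (a * l1_norm x)"
  shows "integrable \<mu> h"
proof (rule Bochner_Integration.integrable_bound)
  show "integrable \<mu> (\<lambda>x. C * exp (a * l1_norm x))"
    using integrable_exp by simp
  have "norm (h x) \<le> norm (C * exp (a * l1_norm x))" for x
    using assms(2)[of x] by (simp add: order_trans[OF _ abs_ge_self])
  then show "AE x in \<mu>. norm (h x) \<le> norm (C * exp (a * l1_norm x))"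
    by simp
qed (use assms measurable_mu in auto)

lemma subexp_integrable: "subexp h \<Longrightarrow> integrable \<mu> h"
  using a_pos integrable_exp_bound unfolding subexp_def by blast

section \<open>Bounded functions that polynomials approximate under every polynomial weight\<close>

text \<open>The polynomial \<open>q\<close> may depend on the weight \<open>w\<close>. Measurability
  and boundedness of \<open>t\<close> make every integrand here subexponential, hence integrable, so
  a small integral is never the default value 0 of a divergent one.\<close>

definition approximable :: "(real ^ 'n \<Rightarrow> real) \<Rightarrow> bool" where
  "approximable t \<longleftrightarrow> t \<in> borel_measurable borel \<and> (\<exists>C. \<forall>x. \<bar>t x\<bar> \<le> C) \<and>
     (\<forall>w \<epsilon>. \<epsilon> > 0 \<longrightarrow>
       (\<exists>q. (LINT x|\<mu>. quad_quart (poly_eval q x - t x) * (poly_eval w x)\<^sup>2) < \<epsilon>))"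

lemma approximable_subexp: "approximable t \<Longrightarrow> subexp t"
  by (auto simp: approximable_def intro: subexp_bounded)

text \<open>The error passes through \<open>t'\<close> by \<open>quad_quart_add_le\<close>. Only
  subexponential growth is asked of \<open>t'\<close>, so that it may mix approximable functions
  with polynomials.\<close>

lemma approximable_close:
  assumes t: "t \<in> borel_measurable borel" "\<And>x. \<bar>t x\<bar> \<le> C"
    and "\<And>w \<epsilon>. \<epsilon> > 0 \<Longrightarrow> \<exists>t'. subexp t' \<and>
      (LINT x|\<mu>. quad_quart (t' x - t x) * (poly_eval w x)\<^sup>2) < \<epsilon> \<and>
      (\<exists>q. (LINT x|\<mu>. quad_quart (poly_eval q x - t' x) * (poly_eval w x)\<^sup>2) < \<epsilon>)"
  shows "approximable t"
proof -
  have st: "subexp t" using t by (rule subexp_bounded)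
  have "\<exists>q. (LINT x|\<mu>. quad_quart (poly_eval q x - t x) * (poly_eval w x)\<^sup>2) < \<epsilon>" if "\<epsilon> > 0" for w \<epsilon>
  proof -
    \<comment> \<open>There are two errors, each multiplied by the 8 of
      \<open>quad_quart_add_le\<close>.\<close>
    have "\<epsilon> / 16 > 0" using that by simp
    from assms(3)[OF this, of w] obtain t' q where t': "subexp t'"
      and 1: "(LINT x|\<mu>. quad_quart (t' x - t x) * (poly_eval w x)\<^sup>2) < \<epsilon> / 16"
      and 2: "(LINT x|\<mu>. quad_quart (poly_eval q x - t' x) * (poly_eval w x)\<^sup>2) < \<epsilon> / 16"
      by blast
    have i: "integrable \<mu> (\<lambda>x. quad_quart (poly_eval q x - t' x) * (poly_eval w x)\<^sup>2)"
      "integrable \<mu> (\<lambda>x. quad_quart (t' x - t x) * (poly_eval w x)\<^sup>2)"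
      "integrable \<mu> (\<lambda>x. quad_quart (poly_eval q x - t x) * (poly_eval w x)\<^sup>2)"
      by (intro subexp_integrable subexp_quad_quart subexp_intros st t')+
    have "(LINT x|\<mu>. quad_quart (poly_eval q x - t x) * (poly_eval w x)\<^sup>2)
        \<le> (LINT x|\<mu>. 8 * (quad_quart (poly_eval q x - t' x) * (poly_eval w x)\<^sup>2
            + quad_quart (t' x - t x) * (poly_eval w x)\<^sup>2))"
    proof (rule integral_mono)
      fix x
      have "quad_quart (poly_eval q x - t x)
          \<le> 8 * (quad_quart (poly_eval q x - t' x) + quad_quart (t' x - t x))"
        using quad_quart_add_le[of "poly_eval q x - t' x" "t' x - t x"] by simp
      from mult_right_mono[OF this, of "(poly_eval w x)\<^sup>2"]
      show "quad_quart (poly_eval q x - t x) * (poly_eval w x)\<^sup>2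
        \<le> 8 * (quad_quart (poly_eval q x - t' x) * (poly_eval w x)\<^sup>2
            + quad_quart (t' x - t x) * (poly_eval w x)\<^sup>2)"
        by (simp add: algebra_simps)
    qed (use i in auto)
    also have "\<dots> < \<epsilon>"
      using 1 2 i by simp
    finally show ?thesis by blast
  qed
  then show ?thesis
    using t unfolding approximable_def by blast
qed

lemma approximable_const: "approximable (\<lambda>x. c)"
  unfolding approximable_def
proof (intro conjI allI impI)
  fix w :: "'n rpoly" and \<epsilon> :: real assume "\<epsilon> > 0"
  then show "\<exists>q. (LINT x|\<mu>. quad_quart (poly_eval q x - c) * (poly_eval w x)\<^sup>2) < \<epsilon>"
    by (intro exI[of _ "Poly_Mapping.single 0 c"]) (simp add: quad_quart_def)
qed auto

text \<open>The common bound \<open>C\<close> supplies the majorant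
  \<open>quad_quart (2 * C)\<close> times the squared weight, so dominated convergence turns
  pointwise convergence into small weighted errors.\<close>

lemma approximable_bounded_limit:
  assumes "\<And>k. approximable (t k)" "\<And>k x. \<bar>t k x\<bar> \<le> C" "\<And>x. (\<lambda>k. t k x) \<longlonglongrightarrow> s x"
  shows "approximable s"
proof (rule approximable_close)
  have tm [measurable]: "\<And>k. t k \<in> borel_measurable borel"
    using assms(1) by (simp add: approximable_def)
  show sm [measurable]: "s \<in> borel_measurable borel"
    by (rule borel_measurable_LIMSEQ_real[OF assms(3)]) auto
  show sC: "\<bar>s x\<bar> \<le> C" for x
    using assms(2,3) by (intro LIMSEQ_le_const2[OF tendsto_rabs[OF assms(3)]]) auto
  fix w :: "'n rpoly" and \<epsilon> :: real assume \<epsilon>: "\<epsilon> > 0"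
  have sub: "subexp (t k)" "subexp s" for k
    by (rule subexp_bounded[OF tm assms(2)], rule subexp_bounded[OF sm sC])
  have "(\<lambda>k. LINT x|\<mu>. quad_quart (t k x - s x) * (poly_eval w x)\<^sup>2) \<longlonglongrightarrow> (LINT x|\<mu>. 0)"
  proof (rule integral_dominated_convergence)
    show "integrable \<mu> (\<lambda>x. quad_quart (2 * C) * (poly_eval w x)\<^sup>2)"
      by (intro subexp_integrable subexp_intros)
    show "AE x in \<mu>. (\<lambda>k. quad_quart (t k x - s x) * (poly_eval w x)\<^sup>2) \<longlonglongrightarrow> 0"
    proof (rule AE_I2)
      fix x
      have "(\<lambda>k. quad_quart (t k x - s x) * (poly_eval w x)\<^sup>2)
          \<longlonglongrightarrow> quad_quart (s x - s x) * (poly_eval w x)\<^sup>2"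
        unfolding quad_quart_def by (intro tendsto_intros assms(3))
      then show "(\<lambda>k. quad_quart (t k x - s x) * (poly_eval w x)\<^sup>2) \<longlonglongrightarrow> 0"
        by (simp add: quad_quart_def)
    qed
    show "AE x in \<mu>. norm (quad_quart (t k x - s x) * (poly_eval w x)\<^sup>2)
        \<le> quad_quart (2 * C) * (poly_eval w x)\<^sup>2" for k
    proof (rule AE_I2)
      fix x
      have "\<bar>t k x - s x\<bar> \<le> 2 * C"
        using assms(2)[of k x] sC[of x] by linarith
      then show "norm (quad_quart (t k x - s x) * (poly_eval w x)\<^sup>2)
        \<le> quad_quart (2 * C) * (poly_eval w x)\<^sup>2"
        by (simp add: abs_mult quad_quart_nonneg quad_quart_mono mult_right_mono)
    qed
    show "(\<lambda>x. quad_quart (t k x - s x) * (poly_eval w x)\<^sup>2) \<in> borel_measurable \<mu>" for k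
      by (intro measurable_mu subexp_measurable subexp_quad_quart subexp_intros sub)
  qed simp
  then have "\<forall>\<^sub>F k in sequentially. (LINT x|\<mu>. quad_quart (t k x - s x) * (poly_eval w x)\<^sup>2) < \<epsilon>"
    using \<epsilon> by (intro order_tendstoD) auto
  then obtain k where "(LINT x|\<mu>. quad_quart (t k x - s x) * (poly_eval w x)\<^sup>2) < \<epsilon>"
    using eventually_happens'[OF sequentially_bot] by blast
  then show "\<exists>t'. subexp t' \<and>
      (LINT x|\<mu>. quad_quart (t' x - s x) * (poly_eval w x)\<^sup>2) < \<epsilon> \<and>
      (\<exists>q. (LINT x|\<mu>. quad_quart (poly_eval q x - t' x) * (poly_eval w x)\<^sup>2) < \<epsilon>)"
    using sub assms(1)[of k] \<epsilon> unfolding approximable_def by blast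
qed

lemma approximable_add:
  assumes "approximable s" "approximable t"
  shows "approximable (\<lambda>x. s x + t x)"
proof -
  obtain C D where C: "\<And>x. \<bar>s x\<bar> \<le> C" and D: "\<And>x. \<bar>t x\<bar> \<le> D"
    using assms unfolding approximable_def by metis
  show ?thesis
  proof (rule approximable_close)
    show "(\<lambda>x. s x + t x) \<in> borel_measurable borel"
      using assms by (auto simp: approximable_def)
    show "\<bar>s x + t x\<bar> \<le> C + D" for x
      using C[of x] D[of x] by linarith
    fix w :: "'n rpoly" and \<epsilon> :: real assume \<epsilon>: "\<epsilon> > 0"
    then obtain p q where p: "(LINT x|\<mu>. quad_quart (poly_eval p x - s x) * (poly_eval w x)\<^sup>2) < \<epsilon>"
      and q: "(LINT x|\<mu>. quad_quart (poly_eval q x - t x) * (poly_eval w x)\<^sup>2) < \<epsilon>"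
      using assms unfolding approximable_def by blast
    show "\<exists>t'. subexp t' \<and>
      (LINT x|\<mu>. quad_quart (t' x - (s x + t x)) * (poly_eval w x)\<^sup>2) < \<epsilon> \<and>
      (\<exists>q. (LINT x|\<mu>. quad_quart (poly_eval q x - t' x) * (poly_eval w x)\<^sup>2) < \<epsilon>)"
    proof (intro exI conjI)
      \<comment> \<open>One summand is replaced at a time: going from \<open>s + t\<close> to
        \<open>s + q\<close> costs the error of \<open>q\<close>, and from there to
        \<open>p + q\<close> the error of \<open>p\<close>.\<close>
      show "subexp (\<lambda>x. s x + poly_eval q x)"
        using assms by (intro subexp_intros approximable_subexp)
      show "(LINT x|\<mu>. quad_quart (s x + poly_eval q x - (s x + t x)) * (poly_eval w x)\<^sup>2) < \<epsilon>"
        using q by simp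
      show "(LINT x|\<mu>. quad_quart (poly_eval (p + q) x - (s x + poly_eval q x)) * (poly_eval w x)\<^sup>2) < \<epsilon>"
        using p by simp
    qed
  qed
qed

text \<open>The arbitrary polynomial weight makes this work: approximate \<open>t\<close> by \<open>q\<close> first, then
  \<open>s\<close> with a weight depending on \<open>q\<close>.\<close>

lemma approximable_mult:
  assumes "approximable s" "approximable t"
  shows "approximable (\<lambda>x. s x * t x)"
proof -
  obtain C D where C: "\<And>x. \<bar>s x\<bar> \<le> C" and D: "\<And>x. \<bar>t x\<bar> \<le> D"
    using assms unfolding approximable_def by metis
  have [intro]: "subexp s" "subexp t"
    using assms by (auto intro: approximable_subexp)
  have C0: "C \<ge> 0" using C[of 0] by linarith
  show ?thesis
  proof (rule approximable_close)
    show "(\<lambda>x. s x * t x) \<in> borel_measurable borel"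
      using assms by (auto simp: approximable_def)
    show "\<bar>s x * t x\<bar> \<le> C * D" for x
      unfolding abs_mult using C[of x] D[of x] C0 by (intro mult_mono) auto
    fix w :: "'n rpoly" and \<epsilon> :: real assume \<epsilon>: "\<epsilon> > 0"
    \<comment> \<open>The added 1 keeps \<open>K\<close> positive even for
      \<open>C = 0\<close>.\<close>
    define K where "K = quad_quart C + 1"
    have K: "K > 0" using quad_quart_nonneg[of C] by (simp add: K_def)
    have "\<epsilon> / K > 0" using \<epsilon> K by simp
    then obtain q where q: "(LINT x|\<mu>. quad_quart (poly_eval q x - t x) * (poly_eval w x)\<^sup>2) < \<epsilon> / K"
      using assms(2) unfolding approximable_def by blast
    \<comment> \<open>Since \<open>quad_quart y \<le> (1 + y^2)^2\<close>, the factor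
      \<open>1 + q^2\<close> in the weight absorbs \<open>q\<close> in the error of
      \<open>p * q\<close> against \<open>s * q\<close>.\<close>
    obtain p where p: "(LINT x|\<mu>. quad_quart (poly_eval p x - s x)
        * (poly_eval (w * (1 + q\<^sup>2)) x)\<^sup>2) < \<epsilon>"
      using assms(1) \<epsilon> unfolding approximable_def by blast
    show "\<exists>t'. subexp t' \<and>
      (LINT x|\<mu>. quad_quart (t' x - (s x * t x)) * (poly_eval w x)\<^sup>2) < \<epsilon> \<and>
      (\<exists>q. (LINT x|\<mu>. quad_quart (poly_eval q x - t' x) * (poly_eval w x)\<^sup>2) < \<epsilon>)"
    proof (intro exI conjI)
      show "subexp (\<lambda>x. s x * poly_eval q x)"
        by (intro subexp_intros) auto
      have "(LINT x|\<mu>. quad_quart (s x * poly_eval q x - s x * t x) * (poly_eval w x)\<^sup>2)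
          \<le> (LINT x|\<mu>. K * (quad_quart (poly_eval q x - t x) * (poly_eval w x)\<^sup>2))"
      proof (rule integral_mono)
        fix x
        have "quad_quart (s x * poly_eval q x - s x * t x)
            \<le> quad_quart (s x) * quad_quart (poly_eval q x - t x)"
          using quad_quart_mult_le[of "s x" "poly_eval q x - t x"] by (simp add: right_diff_distrib)
        also have "\<dots> \<le> K * quad_quart (poly_eval q x - t x)"
          using quad_quart_mono[OF C[of x]] by (intro mult_right_mono quad_quart_nonneg) (simp add: K_def)
        finally show "quad_quart (s x * poly_eval q x - s x * t x) * (poly_eval w x)\<^sup>2
          \<le> K * (quad_quart (poly_eval q x - t x) * (poly_eval w x)\<^sup>2)"
          by (simp add: mult_right_mono flip: mult.assoc)
      qed (intro subexp_integrable subexp_quad_quart subexp_intros; blast)+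
      also have "\<dots> < \<epsilon>"
        using q K by (simp add: field_simps)
      finally show "(LINT x|\<mu>. quad_quart (s x * poly_eval q x - s x * t x) * (poly_eval w x)\<^sup>2) < \<epsilon>" .
      have "(LINT x|\<mu>. quad_quart (poly_eval (p * q) x - s x * poly_eval q x) * (poly_eval w x)\<^sup>2)
          \<le> (LINT x|\<mu>. quad_quart (poly_eval p x - s x) * (poly_eval (w * (1 + q\<^sup>2)) x)\<^sup>2)"
      proof (rule integral_mono)
        fix x
        have "quad_quart (poly_eval (p * q) x - s x * poly_eval q x)
            \<le> quad_quart (poly_eval p x - s x) * quad_quart (poly_eval q x)"
          using quad_quart_mult_le[of "poly_eval p x - s x" "poly_eval q x"]
          by (simp add: left_diff_distrib)
        also have "\<dots> \<le> quad_quart (poly_eval p x - s x) * (1 + (poly_eval q x)\<^sup>2)\<^sup>2"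
          by (intro mult_left_mono quad_quart_nonneg)
            (simp add: quad_quart_def power2_sum flip: power_mult)
        finally show "quad_quart (poly_eval (p * q) x - s x * poly_eval q x) * (poly_eval w x)\<^sup>2
          \<le> quad_quart (poly_eval p x - s x) * (poly_eval (w * (1 + q\<^sup>2)) x)\<^sup>2"
          using mult_right_mono[of _ _ "(poly_eval w x)\<^sup>2"] by (fastforce simp: power_mult_distrib mult_ac)
      qed (intro subexp_integrable subexp_quad_quart subexp_intros; blast)+
      then show "(LINT x|\<mu>. quad_quart (poly_eval (p * q) x - s x * poly_eval q x)
          * (poly_eval w x)\<^sup>2) < \<epsilon>"
        using p by linarith
    qed
  qed
qed

lemma approximable_sum:
  "(\<And>i. i \<in> I \<Longrightarrow> approximable (t i)) \<Longrightarrow> approximable (\<lambda>x. \<Sum>i\<in>I. t i x)"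
  by (induction I rule: infinite_finite_induct) (auto intro: approximable_const approximable_add)

text \<open>Only for small frequencies are the Taylor polynomials dominated by an integrable function;
  larger frequencies are never needed.\<close>

lemma approximable_sin:
  assumes "\<bar>c\<bar> \<le> a / 8"
  shows "approximable (\<lambda>x. sin (c * x $ i))"
  unfolding approximable_def
proof (intro conjI allI impI)
  show sm: "(\<lambda>x::real^'n. sin (c * x $ i)) \<in> borel_measurable borel"
    by (intro borel_measurable_continuous_onI continuous_intros)
  show "\<exists>C. \<forall>x::real^'n. \<bar>sin (c * x $ i)\<bar> \<le> C"
    by (intro exI[of _ 1]) simp
  fix w :: "'n rpoly" and \<epsilon> :: real assume \<epsilon>: "\<epsilon> > 0"
  \<comment> \<open>These are the partial sums of the sine series at \<open>c * x $ i\<close>,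
    written as polynomials in \<open>x\<close>.\<close>
  define q :: "nat \<Rightarrow> 'n rpoly" where
    "q m = (\<Sum>k<m. Poly_Mapping.single (Poly_Mapping.single i k) (sin_coeff k * c ^ k))" for m
  have q: "poly_eval (q m) x = (\<Sum>k<m. sin_coeff k *\<^sub>R (c * x $ i) ^ k)" for m x
    by (simp add: q_def poly_eval_single monom_eval_single power_mult_distrib mult_ac)
  \<comment> \<open>Each partial sum is dominated termwise by the exponential series, so the bound
    is uniform in \<open>m\<close>.\<close>
  have qbound: "\<bar>poly_eval (q m) x - sin (c * x $ i)\<bar> \<le> 2 * exp (\<bar>c * x $ i\<bar>)" for m x
  proof -
    have "\<bar>poly_eval (q m) x\<bar> \<le> (\<Sum>k<m. \<bar>c * x $ i\<bar> ^ k /\<^sub>R fact k)"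
      unfolding q
    proof (rule order_trans[OF sum_abs], rule sum_mono)
      fix k
      have "\<bar>sin_coeff k\<bar> \<le> inverse (fact k)"
        by (simp add: sin_coeff_def abs_mult divide_inverse power_abs)
      then show "\<bar>sin_coeff k *\<^sub>R (c * x $ i) ^ k\<bar> \<le> \<bar>c * x $ i\<bar> ^ k /\<^sub>R fact k"
        by (simp add: abs_mult power_abs mult_right_mono)
    qed
    also have "\<dots> \<le> exp (\<bar>c * x $ i\<bar>)"
      using exp_converges[of "\<bar>c * x $ i\<bar>"]
      by (intro sum_le_suminf[where I = "{..<m}", THEN order_trans]) (auto simp: sums_iff)
    finally have "\<bar>poly_eval (q m) x\<bar> \<le> exp (\<bar>c * x $ i\<bar>)" .
    moreover have "\<bar>sin (c * x $ i)\<bar> \<le> exp (\<bar>c * x $ i\<bar>)"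
      by (rule order_trans[OF abs_sin_le_one]) simp
    ultimately show ?thesis by linarith
  qed
  have "subexp (\<lambda>x. (poly_eval w x)\<^sup>2)" by (intro subexp_intros)
  then obtain C where C: "\<And>x. \<bar>(poly_eval w x)\<^sup>2\<bar> \<le> C * exp (a / 2 * l1_norm x)"
    unfolding subexp_def using a_pos half_gt_zero by blast
  \<comment> \<open>The hypothesis on \<open>c\<close> turns the fourth power of
    \<open>exp \<bar>c * x $ i\<bar>\<close> into growth of rate at most \<open>a / 2\<close>; the
    weight takes the other \<open>a / 2\<close>. The 20 is \<open>2^2 + 2^4\<close>.\<close>
  define D where "D x = 20 * exp (a / 2 * l1_norm x) * (C * exp (a / 2 * l1_norm x))"
    for x :: "real ^ 'n"
  have D: "D x = 20 * C * exp (a * l1_norm x)" for x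
  proof -
    have "exp (a * l1_norm x) = exp (a / 2 * l1_norm x) * exp (a / 2 * l1_norm x)"
      unfolding exp_add[symmetric] by simp
    then show ?thesis by (simp add: D_def)
  qed
  have bound: "quad_quart (poly_eval (q m) x - sin (c * x $ i)) * (poly_eval w x)\<^sup>2 \<le> D x" for m x
    unfolding D_def
  proof (rule mult_mono)
    let ?e = "exp (\<bar>c * x $ i\<bar>)"
    have "quad_quart (poly_eval (q m) x - sin (c * x $ i)) \<le> quad_quart (2 * ?e)"
      by (rule quad_quart_mono[OF qbound])
    also have "\<dots> = 4 * ?e\<^sup>2 + 16 * ?e ^ 4"
      by (simp add: quad_quart_def power_mult_distrib)
    also have "\<dots> \<le> 20 * ?e ^ 4"
      using power_increasing[of 2 4 ?e] by simp
    also have "?e ^ 4 = exp (4 * \<bar>c * x $ i\<bar>)"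
      by (simp flip: exp_of_nat_mult)
    also have "exp (4 * \<bar>c * x $ i\<bar>) \<le> exp (a / 2 * l1_norm x)"
    proof -
      have "\<bar>x $ i\<bar> \<le> l1_norm x"
        by (rule member_le_sum) auto
      then have "\<bar>c\<bar> * \<bar>x $ i\<bar> \<le> a / 8 * l1_norm x"
        using assms by (intro mult_mono) auto
      then show ?thesis by (simp add: abs_mult)
    qed
    finally show "quad_quart (poly_eval (q m) x - sin (c * x $ i)) \<le> 20 * exp (a / 2 * l1_norm x)"
      by simp
    show "(poly_eval w x)\<^sup>2 \<le> C * exp (a / 2 * l1_norm x)"
      using C[of x] by simp
  qed auto
  have "(\<lambda>m. LINT x|\<mu>. quad_quart (poly_eval (q m) x - sin (c * x $ i)) * (poly_eval w x)\<^sup>2)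
      \<longlonglongrightarrow> (LINT x|\<mu>. 0)"
  proof (rule integral_dominated_convergence)
    show "integrable \<mu> D"
      unfolding D using integrable_exp by simp
    have "(\<lambda>m. quad_quart (poly_eval (q m) x - sin (c * x $ i)) * (poly_eval w x)\<^sup>2) \<longlonglongrightarrow> 0" for x
    proof -
      have "(\<lambda>m. poly_eval (q m) x) \<longlonglongrightarrow> sin (c * x $ i)"
        using sin_converges[of "c * x $ i"] by (simp add: q sums_def)
      then have "(\<lambda>m. quad_quart (poly_eval (q m) x - sin (c * x $ i)) * (poly_eval w x)\<^sup>2)
          \<longlonglongrightarrow> quad_quart (sin (c * x $ i) - sin (c * x $ i)) * (poly_eval w x)\<^sup>2"
        unfolding quad_quart_def by (intro tendsto_intros)
      then show ?thesis by (simp add: quad_quart_def)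
    qed
    then show "AE x in \<mu>. (\<lambda>m. quad_quart (poly_eval (q m) x - sin (c * x $ i)) * (poly_eval w x)\<^sup>2)
        \<longlonglongrightarrow> 0"
      by simp
    show "AE x in \<mu>. norm (quad_quart (poly_eval (q m) x - sin (c * x $ i)) * (poly_eval w x)\<^sup>2) \<le> D x"
      for m
      using bound by (simp add: abs_mult quad_quart_nonneg)
    have "subexp (\<lambda>x::real^'n. sin (c * x $ i))"
      by (rule subexp_bounded[OF sm, where C = 1]) simp
    then show "(\<lambda>x. quad_quart (poly_eval (q m) x - sin (c * x $ i)) * (poly_eval w x)\<^sup>2)
        \<in> borel_measurable \<mu>" for m
      by (intro measurable_mu subexp_measurable subexp_quad_quart subexp_intros)
  qed simp
  then have "\<forall>\<^sub>F m in sequentially.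
      (LINT x|\<mu>. quad_quart (poly_eval (q m) x - sin (c * x $ i)) * (poly_eval w x)\<^sup>2) < \<epsilon>"
    using \<epsilon> by (intro order_tendstoD) auto
  then show "\<exists>q. (LINT x|\<mu>. quad_quart (poly_eval q x - sin (c * x $ i)) * (poly_eval w x)\<^sup>2) < \<epsilon>"
    using eventually_happens'[OF sequentially_bot] by blast
qed

text \<open>A linear functional is a finite combination of coordinates, and the remaining generators
  are handled by closure under constants, sums and products.\<close>

lemma approximable_real_polynomial_function:
  assumes "real_polynomial_function h" "\<And>i. approximable (\<lambda>x. b x $ i)"
  shows "approximable (\<lambda>x. h (b x))"
  using assms(1)
proof induction
  case (linear h)
  have *: "h y = (\<Sum>i\<in>UNIV. y $ i * h (axis i 1))" for y
  proof -
    have "h y = h (\<Sum>i\<in>UNIV. (y $ i) *\<^sub>R axis i 1)"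
      using basis_expansion[of y] by (simp add: scalar_mult_eq_scaleR)
    then show ?thesis
      using bounded_linear.linear[OF linear] by (simp only: linear_sum linear_scale real_scaleR_def)
  qed
  have "approximable (\<lambda>x. \<Sum>i\<in>UNIV. b x $ i * h (axis i 1))"
    using assms(2) by (intro approximable_sum approximable_mult approximable_const)
  then show ?case
    by (subst *)
next
  case (const c)
  show ?case by (rule approximable_const)
next
  case (add h k)
  from add.IH show ?case by (rule approximable_add)
next
  case (mult h k)
  from mult.IH show ?case by (rule approximable_mult)
qed

text \<open>Approximable functions form an algebra, so a continuous function of
  \<open>sin (c * x\<^sub>i / N)\<close> is approximable by the Weierstrass theorem, and
  \<open>N / c * sin (c * x\<^sub>i / N)\<close> tends to \<open>x\<^sub>i\<close>.\<close>

lemma approximable_continuous: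
  assumes F: "continuous_on UNIV F" "\<And>x. \<bar>F x\<bar> \<le> C"
  shows "approximable F"
proof -
  \<comment> \<open>The factor \<open>a / 8\<close> is the largest frequency that
    \<open>approximable_sin\<close> admits; the frequencies decrease to 0.\<close>
  define e where "e N = (a / 8) * inverse (real (Suc N))" for N
  have e_pos: "e N > 0" for N using a_pos by (simp add: e_def)
  have e_lim: "e \<longlonglongrightarrow> 0"
    unfolding e_def[abs_def] using LIMSEQ_inverse_real_of_nat
    by (intro tendsto_mult_right_zero) auto
  \<comment> \<open>Each \<open>b N\<close> maps the whole space into the compact box
    \<open>B N\<close>, and \<open>b N x\<close> tends to \<open>x\<close>. Composition with it
    turns Weierstrass approximation on boxes into approximation on the whole space.\<close>
  define b :: "nat \<Rightarrow> real ^ 'n \<Rightarrow> real ^ 'n" where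
    "b N x = (\<chi> i. sin (e N * x $ i) * inverse (e N))" for N x
  have appr: "approximable (\<lambda>x. b N x $ i)" for N i
  proof -
    have "inverse (real (Suc N)) \<le> 1" by (simp add: field_simps)
    then have "\<bar>e N\<bar> \<le> a / 8"
      using a_pos mult_left_mono[of "inverse (real (Suc N))" 1 "a / 8"] e_pos[of N] by (simp add: e_def)
    then show ?thesis
      by (auto simp: b_def intro!: approximable_mult approximable_sin approximable_const)
  qed
  define B :: "nat \<Rightarrow> (real ^ 'n) set" where "B N = cbox (\<chi> i. - inverse (e N)) (\<chi> i. inverse (e N))" for N
  have bB: "b N x \<in> B N" for N x
  proof -
    have "\<bar>sin (e N * x $ i) * inverse (e N)\<bar> \<le> 1 * inverse (e N)" for i
      unfolding abs_mult using e_pos[of N] by (intro mult_mono) auto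
    then show ?thesis
      by (simp add: B_def b_def mem_box_cart abs_le_iff minus_le_iff)
  qed
  have "\<exists>h. real_polynomial_function h \<and> (\<forall>x\<in>B N. \<bar>F x - h x\<bar> < inverse (real (Suc N)))" for N
  proof -
    have "compact (B N)" "continuous_on (B N) F" "0 < inverse (real (Suc N))"
      using F(1) by (auto simp: B_def intro: continuous_on_subset)
    then show ?thesis
      by (rule Stone_Weierstrass_real_polynomial_function) blast
  qed
  then obtain h where h: "\<And>N. real_polynomial_function (h N)"
    "\<And>N x. x \<in> B N \<Longrightarrow> \<bar>F x - h N x\<bar> < inverse (real (Suc N))"
    by metis
  show ?thesis
  proof (rule approximable_bounded_limit)
    show "approximable (\<lambda>x. h N (b N x))" for N
      by (rule approximable_real_polynomial_function[OF h(1) appr])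
    show "\<bar>h N (b N x)\<bar> \<le> C + 1" for N x
    proof -
      have "inverse (real (Suc N)) \<le> 1" by (simp add: field_simps)
      then show ?thesis
        using h(2)[OF bB, of N x] F(2)[of "b N x"] by linarith
    qed
    fix x
    have "(\<lambda>N. b N x $ i) \<longlonglongrightarrow> x $ i" for i
    \<comment> \<open>The limit of \<open>sin z / z\<close> applies only along nonzero
      \<open>z\<close>; for \<open>x $ i = 0\<close> the sequence is constantly 0.\<close>
    proof (cases "x $ i = 0")
      case False
      have "filterlim (\<lambda>N. e N * x $ i) (at 0) sequentially"
        using e_pos False by (intro filterlim_atI tendsto_mult_left_zero e_lim) (auto simp: less_imp_neq[symmetric])
      moreover have "((\<lambda>z::real. sin z / z) \<longlongrightarrow> 1) (at 0)"
        using DERIV_sin[of "0 :: real"] by (simp add: DERIV_def)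
      ultimately have "(\<lambda>N. sin (e N * x $ i) / (e N * x $ i)) \<longlonglongrightarrow> 1"
        using filterlim_compose by blast
      then have "(\<lambda>N. x $ i * (sin (e N * x $ i) / (e N * x $ i))) \<longlonglongrightarrow> x $ i * 1"
        by (intro tendsto_intros)
      then show ?thesis
        using False by (simp add: b_def field_simps)
    qed (simp add: b_def)
    then have "(\<lambda>N. b N x) \<longlonglongrightarrow> x"
      by (intro vec_tendstoI)
    then have "(\<lambda>N. F (b N x)) \<longlonglongrightarrow> F x"
      using F(1) by (auto simp: continuous_on_eq_continuous_at intro: isCont_tendsto_compose)
    moreover have "(\<lambda>N. h N (b N x) - F (b N x)) \<longlonglongrightarrow> 0"
      using h(2)[OF bB] by (intro Lim_null_comparison[OF _ LIMSEQ_inverse_real_of_nat])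
        (auto simp: abs_minus_commute intro!: always_eventually less_imp_le)
    ultimately show "(\<lambda>N. h N (b N x)) \<longlonglongrightarrow> F x"
      using tendsto_add by fastforce
  qed
qed

section \<open>Convergence of the relaxations\<close>

lemma riesz_set_integral:
  assumes [measurable]: "S \<in> sets borel"
  shows "riesz (\<lambda>\<alpha>. LINT x:S|\<mu>. monom_eval \<alpha> x) p = (LINT x:S|\<mu>. poly_eval p x)"
proof -
  have *: "integrable \<mu> (\<lambda>x. indicator S x * monom_eval \<alpha> x)" for \<alpha>
    by (intro subexp_integrable subexp_intros subexp_bounded[where C = 1]) (auto simp: indicator_def)
  show ?thesis
    unfolding riesz_def poly_eval_def set_lebesgue_integral_def
    by (simp add: sum_distrib_left mult.left_commute[of "indicator S _"] * Bochner_Integration.integral_sum)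
qed

lemma riesz_moment: "riesz (moment \<mu>) p = (LINT x|\<mu>. poly_eval p x)"
  using riesz_set_integral[of UNIV p] by (simp add: moment_def[abs_def] set_lebesgue_integral_def)

text \<open>This brings the entries into the shape of \<open>psd_on_integral\<close>, with the
  indicator of \<open>S\<close> times \<open>g\<close> as weight.\<close>

lemma localizing_matrix_set_integral:
  assumes "S \<in> sets borel"
  shows "localizing_matrix g (\<lambda>\<alpha>. LINT x:S|\<mu>. monom_eval \<alpha> x) =
    (\<lambda>\<alpha> \<beta>. LINT x|\<mu>. monom_eval \<alpha> x * monom_eval \<beta> x * (indicator S x * poly_eval g x))"
proof (intro ext)
  fix \<alpha> \<beta> :: "'n mindex"
  have "localizing_matrix g (\<lambda>\<alpha>. LINT x:S|\<mu>. monom_eval \<alpha> x) \<alpha> \<beta>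
      = riesz (\<lambda>\<alpha>. LINT x:S|\<mu>. monom_eval \<alpha> x) (Poly_Mapping.single (\<alpha> + \<beta>) 1 * g)"
    by (simp add: riesz_mult riesz_single) (simp add: localizing_matrix_def riesz_def)
  also have "\<dots> = (LINT x:S|\<mu>. monom_eval \<alpha> x * monom_eval \<beta> x * poly_eval g x)"
    by (simp add: riesz_set_integral[OF assms] poly_eval_single monom_eval_add)
  finally show "localizing_matrix g (\<lambda>\<alpha>. LINT x:S|\<mu>. monom_eval \<alpha> x) \<alpha> \<beta>
      = (LINT x|\<mu>. monom_eval \<alpha> x * monom_eval \<beta> x * (indicator S x * poly_eval g x))"
    by (simp add: set_lebesgue_integral_def mult_ac)
qed

lemma psd_on_localizing_matrix_set_integral:
  assumes [measurable]: "S \<in> sets borel" and "\<And>x. x \<in> S \<Longrightarrow> 0 \<le> poly_eval g x"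
  shows "psd_on I (localizing_matrix g (\<lambda>\<alpha>. LINT x:S|\<mu>. monom_eval \<alpha> x))"
  unfolding localizing_matrix_set_integral[OF assms(1)]
proof (rule psd_on_integral)
  show "integrable \<mu> (\<lambda>x. monom_eval \<alpha> x * monom_eval \<beta> x * (indicator S x * poly_eval g x))" for \<alpha> \<beta>
    by (intro subexp_integrable subexp_intros subexp_bounded[where C = 1]) (auto simp: indicator_def)
qed (use assms(2) in \<open>auto simp: indicator_def\<close>)

lemma psd_on_moment_matrix_set_integral:
  assumes "S \<in> sets borel"
  shows "psd_on I (moment_matrix (\<lambda>\<alpha>. LINT x:S|\<mu>. monom_eval \<alpha> x))"
proof -
  have "moment_matrix (\<lambda>\<alpha>. LINT x:S|\<mu>. monom_eval \<alpha> x)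
      = localizing_matrix 1 (\<lambda>\<alpha>. LINT x:S|\<mu>. monom_eval \<alpha> x)"
    by (auto simp: moment_matrix_def localizing_matrix_def fun_eq_iff)
  then show ?thesis
    using psd_on_localizing_matrix_set_integral[OF assms, of 1] by simp
qed

text \<open>The restrictions of the measure to the set and to its complement add up to the measure,
  and each constraint is nonnegative on the set.\<close>

lemma sdp_feasible_set_integral:
  "sdp_feasible \<mu> d G (\<lambda>\<alpha>. LINT x:semialg G|\<mu>. monom_eval \<alpha> x)
     (\<lambda>\<alpha>. LINT x:- semialg G|\<mu>. monom_eval \<alpha> x)"
proof -
  have S [measurable]: "semialg G \<in> sets borel" "- semialg G \<in> sets borel"
    using closed_semialg[of G] by (auto intro: borel_closed)
  have "(LINT x:semialg G|\<mu>. monom_eval \<alpha> x) + (LINT x:- semialg G|\<mu>. monom_eval \<alpha> x) = moment \<mu> \<alpha>"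
    for \<alpha>
  proof -
    have "integrable \<mu> (\<lambda>x. indicator A x * monom_eval \<alpha> x)" if "A \<in> sets borel" for A
      using that by (intro subexp_integrable subexp_intros subexp_bounded[where C = 1])
        (auto simp: indicator_def)
    then have "(LINT x:semialg G|\<mu>. monom_eval \<alpha> x) + (LINT x:- semialg G|\<mu>. monom_eval \<alpha> x)
        = (LINT x|\<mu>. indicator (semialg G) x * monom_eval \<alpha> x
             + indicator (- semialg G) x * monom_eval \<alpha> x)"
      using S by (simp add: set_lebesgue_integral_def)
    also have "\<dots> = moment \<mu> \<alpha>"
      unfolding moment_def by (intro Bochner_Integration.integral_cong) (auto simp: indicator_def)
    finally show ?thesis .
  qed
  then show ?thesis
    unfolding sdp_feasible_def
    using psd_on_moment_matrix_set_integral[OF S(1)] psd_on_moment_matrix_set_integral[OF S(2)]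
      psd_on_localizing_matrix_set_integral[OF S(1)]
    by (auto simp: semialg_def)
qed

lemma sdp_sup_ge: "ereal (LINT x:semialg G|\<mu>. (poly_eval f x)\<^sup>2) \<le> sdp_sup \<mu> d (f\<^sup>2) G"
  unfolding sdp_sup_def
proof (rule Sup_upper)
  have "semialg G \<in> sets borel"
    using closed_semialg[of G] by (auto intro: borel_closed)
  from riesz_set_integral[OF this, of "f\<^sup>2"] sdp_feasible_set_integral[of d G]
  show "ereal (LINT x:semialg G|\<mu>. (poly_eval f x)\<^sup>2) \<in>
      {ereal (riesz u (f\<^sup>2)) | u v. sdp_feasible \<mu> d G u v}"
    by force
qed

section \<open>Approximate dual certificates\<close>

text \<open>Expanding \<open>(c * h - 1)^2 \<ge> 0\<close> gives Cauchy-Schwarz with a free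
  parameter. The argument returns in \<open>riesz_feasible_le\<close> for functionals in place of
  integrals.\<close>

lemma integral_le_integral_square:
  assumes "subexp h" "c > 0"
  shows "(LINT x|\<mu>. h x) \<le> (c * (LINT x|\<mu>. (h x)\<^sup>2) + measure \<mu> UNIV / c) / 2"
proof -
  have i: "integrable \<mu> h" "integrable \<mu> (\<lambda>x. (h x)\<^sup>2)" "integrable \<mu> (\<lambda>x. 1 / c)"
    using assms by (auto intro!: subexp_integrable subexp_intros)
  have "(LINT x|\<mu>. h x) \<le> (LINT x|\<mu>. (c * (h x)\<^sup>2 + 1 / c) / 2)"
  proof (rule integral_mono)
    fix x
    have "0 \<le> (c * h x - 1)\<^sup>2 / c" using assms(2) by simp
    also have "\<dots> = c * (h x)\<^sup>2 - 2 * h x + 1 / c"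
      using assms(2) by (simp add: power2_eq_square field_simps)
    finally show "h x \<le> (c * (h x)\<^sup>2 + 1 / c) / 2" by simp
  qed (use i in auto)
  also have "\<dots> = (c * (LINT x|\<mu>. (h x)\<^sup>2) + measure \<mu> UNIV / c) / 2"
    using i by (simp add: space_mu)
  finally show ?thesis .
qed

text \<open>On the set the penalty vanishes and the factor is 1 for every \<open>k\<close>; off the
  set the penalty is positive and the factor tends to 0. The square of \<open>f\<close> is an
  integrable majorant.\<close>

lemma penalised_integral_tendsto:
  assumes "finite G"
  shows "(\<lambda>k. LINT x|\<mu>. (poly_eval f x)\<^sup>2 * (1 / (1 + real k * penalty G x)))
    \<longlonglongrightarrow> (LINT x:semialg G|\<mu>. (poly_eval f x)\<^sup>2)"
  unfolding set_lebesgue_integral_def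
proof (rule integral_dominated_convergence)
  have S: "semialg G \<in> sets borel"
    using closed_semialg[of G] by (auto intro: borel_closed)
  have pen: "0 < 1 + real k * penalty G x" for k x
    using penalty_nonneg[of G x] by (simp add: add_pos_nonneg)
  have le: "1 / (1 + real k * penalty G x) \<le> 1" for k x
    using penalty_nonneg[of G x] pen[of k x] by (simp add: divide_le_eq_1)
  show "(\<lambda>x. indicator (semialg G) x *\<^sub>R (poly_eval f x)\<^sup>2) \<in> borel_measurable \<mu>"
    unfolding real_scaleR_def using S
    by (intro measurable_mu borel_measurable_times borel_measurable_indicator borel_measurable_power
      subexp_measurable[OF subexp_poly_eval])
  show "(\<lambda>x. (poly_eval f x)\<^sup>2 * (1 / (1 + real k * penalty G x))) \<in> borel_measurable \<mu>" for k
    using pen by (intro measurable_mu borel_measurable_continuous_onI continuous_intros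
      continuous_on_penalty continuous_on_poly_eval) (auto simp: less_imp_neq[symmetric])
  show "integrable \<mu> (\<lambda>x. (poly_eval f x)\<^sup>2)"
    by (intro subexp_integrable subexp_intros)
  show "AE x in \<mu>. norm ((poly_eval f x)\<^sup>2 * (1 / (1 + real k * penalty G x))) \<le> (poly_eval f x)\<^sup>2" for k
  proof (rule AE_I2)
    fix x
    have "\<bar>1 / (1 + real k * penalty G x)\<bar> \<le> 1"
      using le[of k x] pen[of k x] by simp
    then show "norm ((poly_eval f x)\<^sup>2 * (1 / (1 + real k * penalty G x))) \<le> (poly_eval f x)\<^sup>2"
      using mult_left_mono[of _ 1 "(poly_eval f x)\<^sup>2"] by (fastforce simp: abs_mult)
  qed
  have "(\<lambda>k. (poly_eval f x)\<^sup>2 * (1 / (1 + real k * penalty G x)))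
      \<longlonglongrightarrow> indicator (semialg G) x *\<^sub>R (poly_eval f x)\<^sup>2" for x
  proof (cases "x \<in> semialg G")
    case True
    then show ?thesis
      using penalty_eq_0_iff[OF assms, of x] by simp
  next
    case False
    then have "penalty G x > 0"
      using penalty_nonneg[of G x] penalty_eq_0_iff[OF assms, of x] by linarith
    then have "filterlim (\<lambda>k. 1 + real k * penalty G x) at_infinity sequentially"
      by (intro filterlim_at_top_imp_at_infinity filterlim_tendsto_add_at_top[OF tendsto_const]
        filterlim_at_top_mult_tendsto_pos[OF tendsto_const] filterlim_real_sequentially)
    then have "(\<lambda>k. (poly_eval f x)\<^sup>2 * (1 / (1 + real k * penalty G x))) \<longlonglongrightarrow> (poly_eval f x)\<^sup>2 * 0"
      by (intro tendsto_intros tendsto_divide_0[OF tendsto_const])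
    then show ?thesis
      using False by simp
  qed
  then show "AE x in \<mu>. (\<lambda>k. (poly_eval f x)\<^sup>2 * (1 / (1 + real k * penalty G x)))
      \<longlonglongrightarrow> indicator (semialg G) x *\<^sub>R (poly_eval f x)\<^sup>2"
    by simp
qed

text \<open>The first bound makes the certificate small in mean square, the second keeps its leading
  square close to the wanted integral. One choice of \<open>k\<close>, followed by one choice of
  polynomials, serves both.\<close>

lemma approximate_certificate:
  assumes G: "finite G" and \<delta>: "\<delta> > 0"
  shows "\<exists>q0 q.
    (LINT x|\<mu>. (poly_eval (f\<^sup>2 - (f * q0)\<^sup>2 + (\<Sum>g\<in>G. g * (f * q g)\<^sup>2)) x)\<^sup>2) < \<delta> \<and>
    (LINT x|\<mu>. (poly_eval (f * q0) x)\<^sup>2) < (LINT x:semialg G|\<mu>. (poly_eval f x)\<^sup>2) + \<delta>"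
proof -
  let ?P = "penalty G" and ?f = "poly_eval f"
  have "\<forall>\<^sub>F k in sequentially. (LINT x|\<mu>. (?f x)\<^sup>2 * (1 / (1 + real k * ?P x)))
      < (LINT x:semialg G|\<mu>. (?f x)\<^sup>2) + \<delta> / 2"
    using \<delta> by (intro order_tendstoD[OF penalised_integral_tendsto[OF G]]) simp
  then obtain k where k: "(LINT x|\<mu>. (?f x)\<^sup>2 * (1 / (1 + real k * ?P x)))
      < (LINT x:semialg G|\<mu>. (?f x)\<^sup>2) + \<delta> / 2"
    using eventually_happens'[OF sequentially_bot] by blast
  define m where "m g x = max 0 (- poly_eval g x)" for g and x :: "real ^ 'n"
  define t0 where "t0 x = sqrt (1 / (1 + real k * ?P x))" for x
  define t where "t g x = sqrt (real k * m g x / (1 + real k * ?P x))" for g x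
  define C where "C = sqrt (real k + 1)"
  have pen: "0 < 1 + real k * ?P x" for x
    using penalty_nonneg[of G x] by (simp add: add_pos_nonneg)
  have m0: "0 \<le> m g x" for g x by (simp add: m_def)
  have t0_sq: "(t0 x)\<^sup>2 = 1 / (1 + real k * ?P x)" for x
    using pen[of x] by (simp add: t0_def)
  have t_sq: "(t g x)\<^sup>2 = real k * m g x / (1 + real k * ?P x)" for g x
    using pen[of x] m0[of g x] by (simp add: t_def)
  \<comment> \<open>Because \<open>g * max 0 (- g) = - (max 0 (- g))^2\<close>, the sum equals
    \<open>- k P / (1 + k P)\<close>, which cancels \<open>1 - t0^2\<close>.\<close>
  have identity: "1 - (t0 x)\<^sup>2 + (\<Sum>g\<in>G. poly_eval g x * (t g x)\<^sup>2) = 0" for x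
  proof -
    have "(\<Sum>g\<in>G. poly_eval g x * (t g x)\<^sup>2) = (\<Sum>g\<in>G. - (real k * (m g x)\<^sup>2 / (1 + real k * ?P x)))"
      by (intro sum.cong) (auto simp: t_sq, simp add: m_def max_def power2_eq_square)
    also have "\<dots> = - (real k * ?P x / (1 + real k * ?P x))"
      by (simp add: penalty_def m_def sum_negf sum_distrib_left sum_divide_distrib)
    finally show ?thesis
      using pen[of x] by (simp add: t0_sq field_simps)
  qed
  have t0_le: "\<bar>t0 x\<bar> \<le> C" for x
  proof -
    have "1 / (1 + real k * ?P x) \<le> 1"
      using penalty_nonneg[of G x] pen[of x] by (simp add: divide_le_eq_1)
    then have "t0 x \<le> C" unfolding t0_def C_def by (intro real_sqrt_le_mono) simp
    then show ?thesis
      using pen[of x] by (simp add: t0_def)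
  qed
  \<comment> \<open>The chain is \<open>k m \<le> k (1 + m^2) \<le> k (1 + P) \<le> (k + 1) (1 + k
    P)\<close>; dividing and taking square roots gives \<open>C\<close>.\<close>
  have t_le: "\<bar>t g x\<bar> \<le> C" if "g \<in> G" for g x
  proof -
    have "m g x \<le> 1 + (m g x)\<^sup>2"
      using zero_le_power2[of "m g x - 1"] m0[of g x] by (simp add: power2_eq_square algebra_simps)
    also have "(m g x)\<^sup>2 \<le> ?P x"
      unfolding penalty_def m_def using G that by (intro member_le_sum) auto
    finally have "real k * m g x \<le> real k * (1 + ?P x)"
      by (intro mult_left_mono) auto
    also have "\<dots> \<le> (real k + 1) * (1 + real k * ?P x)"
      using penalty_nonneg[of G x] by (simp add: algebra_simps)
    finally have "real k * m g x / (1 + real k * ?P x) \<le> real k + 1"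
      using pen[of x] by (simp add: divide_le_eq)
    then have "t g x \<le> C" unfolding t_def C_def by (rule real_sqrt_le_mono)
    then show ?thesis
      using pen[of x] m0[of g x] by (simp add: t_def)
  qed
  have t0_ap: "approximable t0"
    unfolding t0_def[abs_def] using pen t0_le unfolding t0_def
    by (intro approximable_continuous[where C = C] continuous_intros continuous_on_penalty)
      (auto simp: less_imp_neq[symmetric])
  have t_ap: "approximable (t g)" if "g \<in> G" for g
    unfolding t_def[abs_def] using pen t_le[OF that] unfolding t_def m_def
    by (intro approximable_continuous[where C = C] continuous_intros continuous_on_penalty
      continuous_on_poly_eval) (auto simp: less_imp_neq[symmetric])
  define M where "M = 8 * C\<^sup>2 + 2"
  define N where "N = real (card G)"
  define K where "K = measure \<mu> UNIV"
  \<comment> \<open>The term \<open>K + 1\<close> keeps \<open>l\<close> positive for every total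
    mass \<open>K\<close> and ensures \<open>K / l \<le> \<delta> / 2\<close>.\<close>
  define l where "l = 2 * (K + 1) / \<delta>"
  have M: "M > 0" by (simp add: M_def add_nonneg_pos)
  have N: "N \<ge> 0" by (simp add: N_def)
  have K: "K \<ge> 0" by (simp add: K_def)
  have l: "l > 0" using K \<delta> by (simp add: l_def)
  \<comment> \<open>The first bound serves the mean square of the certificate, whose errors sum to
    \<open>2 * M * (1 + N * N) * \<eta>\<close>; one \<open>N\<close> counts the constraints, the
    other comes from Cauchy-Schwarz. The second gives
    \<open>l * M * \<eta> \<le> \<delta> / 2\<close> for the linear integral of
    \<open>?h\<close>.\<close>
  define \<eta> where "\<eta> = min (\<delta> / (2 * M * (1 + N * N))) (\<delta> / (2 * l * M))"
  have den: "2 * M * (1 + N * N) > 0" "2 * l * M > 0"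
    using M N l by (simp_all add: add_pos_nonneg)
  then have \<eta>: "\<eta> > 0" using \<delta> by (simp add: \<eta>_def)
  have "\<eta> \<le> \<delta> / (2 * M * (1 + N * N))" "\<eta> \<le> \<delta> / (2 * l * M)"
    by (simp_all add: \<eta>_def)
  then have \<eta>1: "2 * M * (1 + N * N) * \<eta> \<le> \<delta>" and \<eta>2: "2 * l * M * \<eta> \<le> \<delta>"
    unfolding pos_le_divide_eq[OF den(1)] pos_le_divide_eq[OF den(2)] by (simp_all only: mult.commute)
  \<comment> \<open>The weights are, up to sign, the cofactors of \<open>q0^2\<close> and of
    \<open>(q g)^2\<close> in the certificate.\<close>
  obtain q0 where q0: "(LINT x|\<mu>. quad_quart (poly_eval q0 x - t0 x) * (poly_eval (f\<^sup>2) x)\<^sup>2) < \<eta>"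
    using t0_ap \<eta> unfolding approximable_def by blast
  have "\<forall>g\<in>G. \<exists>q. (LINT x|\<mu>. quad_quart (poly_eval q x - t g x) * (poly_eval (f\<^sup>2 * g) x)\<^sup>2) < \<eta>"
    using t_ap \<eta> unfolding approximable_def by blast
  then obtain q where q: "\<And>g. g \<in> G \<Longrightarrow>
      (LINT x|\<mu>. quad_quart (poly_eval (q g) x - t g x) * (poly_eval (f\<^sup>2 * g) x)\<^sup>2) < \<eta>"
    by metis
  note sub = subexp_quad_quart subexp_intros approximable_subexp[OF t0_ap] approximable_subexp[OF t_ap]
  let ?r = "\<lambda>x. quad_quart (poly_eval q0 x - t0 x) * (poly_eval (f\<^sup>2) x)\<^sup>2"
  let ?e = "\<lambda>g x. quad_quart (poly_eval (q g) x - t g x) * (poly_eval (f\<^sup>2 * g) x)\<^sup>2"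
  have e0_int: "integrable \<mu> ?r" and e_int: "\<And>g. g \<in> G \<Longrightarrow> integrable \<mu> (?e g)"
    by (intro subexp_integrable sub; assumption)+
  have d0: "((?f x)\<^sup>2 * ((poly_eval q0 x)\<^sup>2 - (t0 x)\<^sup>2))\<^sup>2 \<le> M * ?r x" for x
    using mult_right_mono[OF square_diff_le_quad_quart[OF t0_le, of "poly_eval q0 x" x], of "((?f x)\<^sup>2)\<^sup>2"]
    by (simp only: M_def power_mult_distrib poly_eval_power mult_ac) simp
  have d: "(poly_eval g x * (?f x)\<^sup>2 * ((poly_eval (q g) x)\<^sup>2 - (t g x)\<^sup>2))\<^sup>2 \<le> M * ?e g x"
    if "g \<in> G" for g x
    using mult_right_mono[OF square_diff_le_quad_quart[OF t_le[OF that], of "poly_eval (q g) x" x],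
      of "((?f x)\<^sup>2 * poly_eval g x)\<^sup>2"]
    by (simp only: M_def power_mult_distrib poly_eval_power poly_eval_mult mult_ac) simp
  let ?W = "f\<^sup>2 - (f * q0)\<^sup>2 + (\<Sum>g\<in>G. g * (f * q g)\<^sup>2)"
  have W: "(poly_eval ?W x)\<^sup>2 \<le> 2 * M * ?r x + 2 * N * M * (\<Sum>g\<in>G. ?e g x)" for x
  proof -
    define A where "A = (?f x)\<^sup>2 * ((poly_eval q0 x)\<^sup>2 - (t0 x)\<^sup>2)"
    define B where "B g = poly_eval g x * (?f x)\<^sup>2 * ((poly_eval (q g) x)\<^sup>2 - (t g x)\<^sup>2)" for g
    \<comment> \<open>Subtracting \<open>f^2\<close> times the left side of \<open>identity\<close>,
      which is 0, leaves only differences of squares of the polynomials and of the functions they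
      approximate.\<close>
    have "poly_eval ?W x = poly_eval ?W x
        - (?f x)\<^sup>2 * (1 - (t0 x)\<^sup>2 + (\<Sum>g\<in>G. poly_eval g x * (t g x)\<^sup>2))"
      by (simp add: identity)
    also have "\<dots> = (\<Sum>g\<in>G. B g) - A"
      by (simp add: A_def B_def power_mult_distrib algebra_simps sum_distrib_left sum_subtractf)
    finally have "(poly_eval ?W x)\<^sup>2 = ((\<Sum>g\<in>G. B g) - A)\<^sup>2" by simp
    also have "\<dots> \<le> 2 * A\<^sup>2 + 2 * (\<Sum>g\<in>G. B g)\<^sup>2"
      using zero_le_power2[of "(\<Sum>g\<in>G. B g) + A"] by (simp add: power2_eq_square algebra_simps)
    also have "\<dots> \<le> 2 * A\<^sup>2 + 2 * ((\<Sum>g\<in>G. (B g)\<^sup>2) * N)"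
      using sum_squared_le_sum_of_squares[of B G] by (simp add: N_def)
    also have "\<dots> \<le> 2 * (M * ?r x) + 2 * ((\<Sum>g\<in>G. M * ?e g x) * N)"
      using d0[of x] d[of _ x] N unfolding A_def B_def
      by (intro add_mono mult_left_mono mult_right_mono sum_mono) auto
    finally show ?thesis
      by (simp add: sum_distrib_left sum_distrib_right mult_ac)
  qed
  have "(LINT x|\<mu>. (poly_eval ?W x)\<^sup>2) \<le> (LINT x|\<mu>. 2 * M * ?r x + 2 * N * M * (\<Sum>g\<in>G. ?e g x))"
  proof (rule integral_mono[OF _ _ W])
    show "integrable \<mu> (\<lambda>x. (poly_eval ?W x)\<^sup>2)"
      by (intro subexp_integrable subexp_intros)
    show "integrable \<mu> (\<lambda>x. 2 * M * ?r x + 2 * N * M * (\<Sum>g\<in>G. ?e g x))"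
      by (intro Bochner_Integration.integrable_add integrable_mult_right
        Bochner_Integration.integrable_sum e0_int e_int)
  qed
  also have "\<dots> = 2 * M * (LINT x|\<mu>. ?r x) + 2 * N * M * (\<Sum>g\<in>G. LINT x|\<mu>. ?e g x)"
    using e0_int e_int
    by (subst Bochner_Integration.integral_add)
      (auto simp: Bochner_Integration.integral_sum simp del: poly_eval_mult poly_eval_power)
  also have "\<dots> < 2 * M * \<eta> + 2 * N * M * (N * \<eta>)"
  proof (rule add_less_le_mono)
    show "2 * M * (LINT x|\<mu>. ?r x) < 2 * M * \<eta>"
      using q0 M by simp
    have "(\<Sum>g\<in>G. LINT x|\<mu>. ?e g x) \<le> (\<Sum>g\<in>G. \<eta>)"
      using q by (intro sum_mono) (auto intro: less_imp_le)
    then show "2 * N * M * (\<Sum>g\<in>G. LINT x|\<mu>. ?e g x) \<le> 2 * N * M * (N * \<eta>)"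
      using N M by (intro mult_left_mono) (auto simp: N_def)
  qed
  also have "\<dots> \<le> \<delta>"
    using \<eta>1 by (simp add: algebra_simps)
  finally have 1: "(LINT x|\<mu>. (poly_eval ?W x)\<^sup>2) < \<delta>" .

  \<comment> \<open>This is the gap between \<open>(f * q0)^2\<close> and \<open>f^2 * t0^2\<close>;
    its integral is controlled through its mean square.\<close>
  let ?h = "\<lambda>x. (?f x)\<^sup>2 * ((poly_eval q0 x)\<^sup>2 - (t0 x)\<^sup>2)"
  have h: "subexp ?h" by (intro sub)
  have "(LINT x|\<mu>. (?h x)\<^sup>2) \<le> (LINT x|\<mu>. M * ?r x)"
    by (intro integral_mono d0 subexp_integrable sub)
  also have "\<dots> < M * \<eta>"
    using q0 M by simp
  finally have hs: "(LINT x|\<mu>. (?h x)\<^sup>2) < M * \<eta>" .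
  have "(LINT x|\<mu>. ?h x) \<le> (l * (LINT x|\<mu>. (?h x)\<^sup>2) + K / l) / 2"
    unfolding K_def by (rule integral_le_integral_square[OF h l])
  also have "\<dots> < (l * (M * \<eta>) + \<delta> / 2) / 2"
  proof -
    have "l * (LINT x|\<mu>. (?h x)\<^sup>2) < l * (M * \<eta>)"
      using hs l by simp
    moreover have "K / l \<le> \<delta> / 2"
      using K \<delta> by (simp add: l_def field_simps)
    ultimately show ?thesis by (simp add: add_less_le_mono)
  qed
  also have "\<dots> \<le> \<delta> / 2"
    using \<eta>2 by (simp add: mult_ac)
  finally have "(LINT x|\<mu>. ?h x) < \<delta> / 2" .
  moreover have "(LINT x|\<mu>. (poly_eval (f * q0) x)\<^sup>2) = (LINT x|\<mu>. ?h x + (?f x)\<^sup>2 * (t0 x)\<^sup>2)"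
    by (intro Bochner_Integration.integral_cong) (auto simp: power_mult_distrib algebra_simps)
  moreover have "\<dots> = (LINT x|\<mu>. ?h x) + (LINT x|\<mu>. (?f x)\<^sup>2 * (t0 x)\<^sup>2)"
    by (intro Bochner_Integration.integral_add subexp_integrable sub)
  ultimately have 2: "(LINT x|\<mu>. (poly_eval (f * q0) x)\<^sup>2) < (LINT x:semialg G|\<mu>. (?f x)\<^sup>2) + \<delta>"
    using k unfolding t0_sq by linarith
  show ?thesis
    using 1 2 by blast
qed

text \<open>The certificate is fixed before the order, so \<open>D\<close> depends only on its
  degrees and the estimate holds for all feasible pairs at once.\<close>

lemma riesz_feasible_le:
  assumes G: "finite G" and \<epsilon>: "\<epsilon> > 0"
  shows "\<exists>D. \<forall>d\<ge>D. \<forall>u v. sdp_feasible \<mu> d G u v \<longrightarrow>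
    riesz u (f\<^sup>2) \<le> (LINT x:semialg G|\<mu>. (poly_eval f x)\<^sup>2) + \<epsilon>"
proof -
  define K where "K = measure \<mu> UNIV"
  \<comment> \<open>By this choice \<open>l * \<epsilon> / 2\<close> equals \<open>K + 1\<close>,
    which exceeds \<open>K\<close>; with \<open>l * \<delta> \<le> \<epsilon> / 2\<close> this
    bounds \<open>riesz u W\<close> by \<open>\<epsilon> / 2\<close>.\<close>
  define l where "l = 2 * (K + 1) / \<epsilon>"
  define \<delta> where "\<delta> = min (\<epsilon> / 2) (\<epsilon> / (2 * l))"
  have K: "K \<ge> 0" by (simp add: K_def)
  have l: "l > 0" using K \<epsilon> by (simp add: l_def)
  have \<delta>: "\<delta> > 0" "\<delta> \<le> \<epsilon> / 2" "l * \<delta> \<le> \<epsilon> / 2"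
    using l \<epsilon> by (auto simp: \<delta>_def min_def field_simps)
  obtain q0 q where
    1: "(LINT x|\<mu>. (poly_eval (f\<^sup>2 - (f * q0)\<^sup>2 + (\<Sum>g\<in>G. g * (f * q g)\<^sup>2)) x)\<^sup>2) < \<delta>" and
    2: "(LINT x|\<mu>. (poly_eval (f * q0) x)\<^sup>2) < (LINT x:semialg G|\<mu>. (poly_eval f x)\<^sup>2) + \<delta>"
    using approximate_certificate[OF G \<delta>(1), of f] by blast
  define W where "W = f\<^sup>2 - (f * q0)\<^sup>2 + (\<Sum>g\<in>G. g * (f * q g)\<^sup>2)"
  \<comment> \<open>Nonnegativity at \<open>(l * W - 1)^2\<close> yields
    \<open>2 l L(W) \<le> l^2 L(W^2) + L(1)\<close>, where \<open>L\<close> is the functional of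
    \<open>u\<close>: Cauchy-Schwarz from positivity on squares alone.\<close>
  define V where "V = Poly_Mapping.single 0 l * W - 1"
  \<comment> \<open>A sum of degrees bounds each of them. The half degrees enter so that subtracting
    \<open>half_deg g\<close> from \<open>d\<close> still leaves room for
    \<open>f * q g\<close>.\<close>
  define D where "D = poly_deg W + poly_deg V + poly_deg (1 :: 'n rpoly) + poly_deg (f * q0)
    + (\<Sum>g\<in>G. half_deg g + poly_deg (f * q g))"
  have "riesz u (f\<^sup>2) \<le> (LINT x:semialg G|\<mu>. (poly_eval f x)\<^sup>2) + \<epsilon>"
    if d: "d \<ge> D" and feas: "sdp_feasible \<mu> d G u v" for d u v
  proof -
    have W_sq: "riesz u (W\<^sup>2) \<le> \<delta>"
      using sdp_feasible_riesz_square_le[OF feas, of W] d 1 by (simp add: D_def riesz_moment W_def)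
    have one: "riesz u 1 \<le> K"
      using sdp_feasible_riesz_square_le[OF feas, of 1] d by (simp add: D_def riesz_moment K_def space_mu)
    have q0: "riesz u ((f * q0)\<^sup>2) \<le> (LINT x|\<mu>. (poly_eval (f * q0) x)\<^sup>2)"
      using sdp_feasible_riesz_square_le[OF feas, of "f * q0"] d by (simp add: D_def riesz_moment)
    have q: "0 \<le> riesz u (g * (f * q g)\<^sup>2)" if "g \<in> G" for g
    proof -
      have "half_deg g + poly_deg (f * q g) \<le> (\<Sum>g\<in>G. half_deg g + poly_deg (f * q g))"
        using G that by (intro member_le_sum) auto
      then have "poly_deg (f * q g) \<le> d - half_deg g"
        using d by (simp add: D_def)
      then show ?thesis
        using feas that by (auto simp: sdp_feasible_def intro: localizing_matrix_psd_riesz_square)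
    qed
    have "0 \<le> riesz u (V\<^sup>2)"
      using feas d by (auto simp: sdp_feasible_def D_def intro: moment_matrix_psd_riesz_square)
    also have "V\<^sup>2 = Poly_Mapping.single 0 (l * l) * W\<^sup>2 - Poly_Mapping.single 0 (2 * l) * W + 1"
    proof -
      have "Poly_Mapping.single 0 (l * l) = Poly_Mapping.single 0 l * (Poly_Mapping.single 0 l :: 'n rpoly)"
        "Poly_Mapping.single 0 (2 * l) = Poly_Mapping.single 0 l + (Poly_Mapping.single 0 l :: 'n rpoly)"
        by (simp_all add: mult_single flip: single_add)
      then show ?thesis
        unfolding V_def by (simp only: power2_eq_square) (simp add: algebra_simps)
    qed
    also have "riesz u \<dots> = l * l * riesz u (W\<^sup>2) - 2 * l * riesz u W + riesz u 1"
      by (simp add: riesz_add riesz_diff riesz_mult[of u "Poly_Mapping.single _ _"] riesz_single)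
    finally have "2 * l * riesz u W \<le> l * (l * \<delta>) + K"
      using W_sq one l by (smt (verit) mult.assoc mult_left_mono)
    also have "\<dots> \<le> l * (\<epsilon> / 2) + l * (\<epsilon> / 2)"
      using \<delta>(3) l K \<epsilon> by (intro add_mono mult_left_mono) (auto simp: l_def)
    finally have "riesz u W \<le> \<epsilon> / 2"
      using l by simp
    moreover have "riesz u W = riesz u (f\<^sup>2) - riesz u ((f * q0)\<^sup>2) + (\<Sum>g\<in>G. riesz u (g * (f * q g)\<^sup>2))"
      by (simp add: W_def riesz_add riesz_diff riesz_sum)
    moreover have "0 \<le> (\<Sum>g\<in>G. riesz u (g * (f * q g)\<^sup>2))"
      using q by (intro sum_nonneg)
    ultimately show ?thesis
      using q0 2 \<delta>(2) by linarith
  qed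
  then show ?thesis by blast
qed

lemma sdp_sup_tendsto:
  assumes "finite G"
  shows "(\<lambda>d. sdp_sup \<mu> d (f\<^sup>2) G) \<longlonglongrightarrow> ereal (LINT x:semialg G|\<mu>. (poly_eval f x)\<^sup>2)"
proof (rule order_tendstoI)
  let ?I = "LINT x:semialg G|\<mu>. (poly_eval f x)\<^sup>2"
  fix y
  show "\<forall>\<^sub>F d in sequentially. y < sdp_sup \<mu> d (f\<^sup>2) G" if "y < ereal ?I"
    using that less_le_trans[OF that sdp_sup_ge] by simp
  assume "ereal ?I < y"
  \<comment> \<open>Bounding all feasible values by a real \<open>r\<close> below \<open>y\<close>
    keeps the supremum strictly below \<open>y\<close>, which may be infinite.\<close>
  then obtain r where r: "ereal ?I < ereal r" "ereal r < y"
    using ereal_dense2 by blast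
  then obtain D where D: "\<And>d u v. d \<ge> D \<Longrightarrow> sdp_feasible \<mu> d G u v \<Longrightarrow> riesz u (f\<^sup>2) \<le> r"
    using riesz_feasible_le[OF assms, of "r - ?I" f] by auto
  have "sdp_sup \<mu> d (f\<^sup>2) G < y" if "d \<ge> D" for d
  proof -
    have "sdp_sup \<mu> d (f\<^sup>2) G \<le> ereal r"
      unfolding sdp_sup_def using D[OF that] by (intro Sup_least) auto
    then show ?thesis using r(2) by (rule le_less_trans)
  qed
  then show "\<forall>\<^sub>F d in sequentially. sdp_sup \<mu> d (f\<^sup>2) G < y"
    using eventually_sequentially by blast
qed

end

section \<open>Gaussian and exponential measures\<close>

text \<open>The integrand is a product of functions of one coordinate each, so its integral factors
  into copies of one finite integral over the line.\<close>

lemma integrable_exp_neg_l1_norm: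
  "integrable lborel (\<lambda>x :: real ^ 'n::finite. exp (- (l1_norm x / 2)))"
proof (rule integrableI_bounded)
  have "(\<integral>\<^sup>+x. ennreal (exp (- (\<bar>x\<bar> / 2))) \<partial>lborel)
      \<le> (\<integral>\<^sup>+x. ennreal (indicator {0..} x * exp (- (1/2) * x)) +
            ennreal (indicator {..0} x * exp (1/2 * x)) \<partial>(lborel :: real measure))"
    by (intro nn_integral_mono) (auto simp: indicator_def)
  also have "\<dots> = (\<integral>\<^sup>+x. ennreal (indicator {0..} x * exp (- (1/2) * x)) \<partial>(lborel :: real measure)) +
      (\<integral>\<^sup>+x. ennreal (indicator {..0} x * exp (1/2 * x)) \<partial>(lborel :: real measure))"
    by (intro nn_integral_add) auto
  also have "(\<integral>\<^sup>+x. ennreal (indicator {..0} x * exp (1/2 * x)) \<partial>(lborel :: real measure))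
      = (\<integral>\<^sup>+x. ennreal (indicator {0..} x * exp (- (1/2) * x)) \<partial>(lborel :: real measure))"
    by (subst nn_integral_real_affine[where c = "-1" and t = 0])
      (auto intro!: nn_integral_cong simp: indicator_def)
  also have "(\<integral>\<^sup>+x. ennreal (indicator {0..} x * exp (- (1/2) * x)) \<partial>(lborel :: real measure))
      = ennreal (exp (- (1/2) * 0) / (1/2))"
  proof (rule nn_integral_has_integral_lborel)
    have "((\<lambda>x. if x \<in> {0..} then exp (- (1/2) * x) else 0 :: real)
        has_integral exp (- (1/2) * 0) / (1/2)) UNIV"
      by (subst has_integral_restrict_UNIV, rule has_integral_exp_minus_to_infinity) simp
    then show "((\<lambda>x. indicator {0..} x * exp (- (1/2) * x) :: real)
        has_integral exp (- (1/2) * 0) / (1/2)) UNIV"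
      by (rule has_integral_eq[rotated]) (simp add: indicator_def)
  qed auto
  finally have fin: "(\<integral>\<^sup>+x. ennreal (exp (- (\<bar>x\<bar> / 2))) \<partial>lborel) < \<infinity>"
    by (rule le_less_trans) (simp flip: ennreal_plus)
  have l1: "l1_norm x = (\<Sum>b\<in>Basis. \<bar>x \<bullet> b\<bar>)" for x :: "real ^ 'n"
  proof -
    have "(\<Sum>b\<in>Basis. \<bar>x \<bullet> b\<bar>) = (\<Sum>i\<in>UNIV. \<bar>x \<bullet> axis i 1\<bar>)"
      by (rule sum.reindex_cong[where l = "\<lambda>i. axis i 1"])
        (auto simp: inj_on_def axis_eq_axis Basis_vec_def)
    then show ?thesis
      by (simp add: cart_eq_inner_axis)
  qed
  have "(\<integral>\<^sup>+x. ennreal (norm (exp (- (l1_norm x / 2)))) \<partial>(lborel :: (real ^ 'n) measure))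
      = (\<integral>\<^sup>+x. (\<Prod>b\<in>Basis. ennreal (exp (- (\<bar>x \<bullet> b\<bar> / 2)))) \<partial>(lborel :: (real ^ 'n) measure))"
    by (intro nn_integral_cong)
      (simp add: l1 prod_ennreal exp_sum sum_divide_distrib prod_nonneg flip: sum_negf)
  also have "\<dots> = (\<Prod>b\<in>(Basis :: (real ^ 'n) set). (\<integral>\<^sup>+x. ennreal (exp (- (\<bar>x\<bar> / 2))) \<partial>lborel))"
    by (subst nn_integral_lborel_prod) auto
  also have "\<dots> < \<infinity>"
    using fin by (simp add: power_less_top_ennreal)
  finally show "(\<integral>\<^sup>+x. ennreal (norm (exp (- (l1_norm x / 2)))) \<partial>(lborel :: (real ^ 'n) measure)) < \<infinity>" .
qed (simp add: borel_measurable_continuous_onI continuous_intros)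

text \<open>Multiplying \<open>exp (- l1_norm x)\<close> by \<open>exp (l1_norm x / 2)\<close>
  leaves \<open>exp (- (l1_norm x / 2))\<close>, which is still integrable.\<close>

lemma exp_moments_density:
  fixes \<rho> :: "real ^ 'n::finite \<Rightarrow> real"
  assumes [measurable]: "\<rho> \<in> borel_measurable borel"
    and "\<And>x. 0 \<le> \<rho> x" "\<And>x. \<rho> x \<le> C * exp (- l1_norm x)"
  shows "exp_moments (density lborel \<rho>) (1/2)"
proof
  have [measurable]: "(\<lambda>x::real^'n. exp (1/2 * l1_norm x)) \<in> borel_measurable borel"
    by (intro borel_measurable_continuous_onI continuous_intros)
  have "integrable lborel (\<lambda>x. \<rho> x *\<^sub>R exp (1/2 * l1_norm x))"
  proof (rule Bochner_Integration.integrable_bound)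
    show "integrable lborel (\<lambda>x::real^'n. C * exp (- (l1_norm x / 2)))"
      by (intro integrable_mult_right integrable_exp_neg_l1_norm)
    have "norm (\<rho> x *\<^sub>R exp (1/2 * l1_norm x)) \<le> norm (C * exp (- (l1_norm x / 2)))" for x
    proof -
      have "\<rho> x * exp (1/2 * l1_norm x) \<le> C * exp (- l1_norm x) * exp (1/2 * l1_norm x)"
        using assms(3) by (intro mult_right_mono) auto
      also have "\<dots> = C * exp (- (l1_norm x / 2))"
        unfolding mult.assoc exp_add[symmetric] by (simp add: field_simps)
      finally show ?thesis
        using assms(2)[of x] by (simp add: order_trans[OF _ abs_ge_self])
    qed
    then show "AE x in lborel. norm (\<rho> x *\<^sub>R exp (1/2 * l1_norm x)) \<le> norm (C * exp (- (l1_norm x / 2)))"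
      by simp
  qed simp
  then show "integrable (density lborel \<rho>) (\<lambda>x. exp (1/2 * l1_norm x))"
    using assms(2) by (subst integrable_density) auto
qed auto

lemma exp_moments_gaussian: "exp_moments (gaussian_measure :: (real ^ 'n::finite) measure) (1/2)"
  unfolding gaussian_measure_def
proof (rule exp_moments_density)
  let ?c = "(2 * pi) powr (- real CARD('n) / 2)"
  show "(\<lambda>x::real^'n. ?c * exp (- (norm x)\<^sup>2 / 2)) \<in> borel_measurable borel"
    by (intro borel_measurable_continuous_onI continuous_intros) auto
  fix x :: "real ^ 'n"
  \<comment> \<open>The inequality \<open>\<bar>t\<bar> \<le> 1/2 + t^2 / 2\<close> is summed over
    the coordinates; the exponential of the constant \<open>CARD('n) / 2\<close> becomes part of the
    factor \<open>C\<close> in \<open>exp_moments_density\<close>.\<close>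
  have "l1_norm x \<le> (\<Sum>i\<in>UNIV. 1/2 + (x $ i)\<^sup>2 / 2)"
  proof (rule sum_mono)
    fix i
    show "\<bar>x $ i\<bar> \<le> 1/2 + (x $ i)\<^sup>2 / 2"
      using zero_le_power2[of "\<bar>x $ i\<bar> - 1"] by (simp add: power2_diff)
  qed
  also have "\<dots> = real CARD('n) / 2 + (norm x)\<^sup>2 / 2"
    by (simp add: norm_vec_def L2_set_def sum_nonneg sum.distrib sum_divide_distrib)
  finally have "- (norm x)\<^sup>2 / 2 \<le> real CARD('n) / 2 + - l1_norm x"
    by simp
  then have "exp (- (norm x)\<^sup>2 / 2) \<le> exp (real CARD('n) / 2 + - l1_norm x)"
    by (rule iffD2[OF exp_le_cancel_iff])
  then have "exp (- (norm x)\<^sup>2 / 2) \<le> exp (real CARD('n) / 2) * exp (- l1_norm x)"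
    unfolding exp_add .
  from mult_left_mono[OF this, of ?c]
  show "?c * exp (- (norm x)\<^sup>2 / 2) \<le> (?c * exp (real CARD('n) / 2)) * exp (- l1_norm x)"
    by (simp add: mult.assoc)
qed simp

text \<open>Moving the indicator inside \<open>ennreal\<close> gives a real-valued density, as
  \<open>exp_moments_density\<close> requires.\<close>

lemma exponential_measure_eq_density:
  "exponential_measure = density lborel (\<lambda>x :: real ^ 'n::finite. ennreal
     ((2 * pi) powr (- real CARD('n) / 2) * exp (- (\<Sum>i\<in>UNIV. x $ i)) * indicator {x. \<forall>i. 0 \<le> x $ i} x))"
  unfolding exponential_measure_def by (intro arg_cong[where f = "density lborel"]) (auto simp: indicator_def)

lemma borel_nonneg_orthant: "{x :: real ^ 'n::finite. \<forall>i. 0 \<le> x $ i} \<in> sets borel"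
  by (intro borel_closed closed_Collect_all closed_Collect_le continuous_intros)

lemma exponential_density_measurable:
  "(\<lambda>x :: real ^ 'n::finite. (2 * pi) powr (- real CARD('n) / 2) * exp (- (\<Sum>i\<in>UNIV. x $ i))
     * indicator {x. \<forall>i. 0 \<le> x $ i} x :: real) \<in> borel_measurable borel"
  by (intro borel_measurable_times borel_measurable_indicator borel_nonneg_orthant
    borel_measurable_continuous_onI continuous_intros)

lemma exp_moments_exponential: "exp_moments (exponential_measure :: (real ^ 'n::finite) measure) (1/2)"
  unfolding exponential_measure_eq_density
proof (rule exp_moments_density[OF exponential_density_measurable])
  fix x :: "real ^ 'n"
  show "(2 * pi) powr (- real CARD('n) / 2) * exp (- (\<Sum>i\<in>UNIV. x $ i)) * indicator {x. \<forall>i. 0 \<le> x $ i} x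
      \<le> (2 * pi) powr (- real CARD('n) / 2) * exp (- l1_norm x)"
    by (auto simp: indicator_def)
qed auto

text \<open>Under integrals, the complement relative to the support can therefore stand for the full
  complement.\<close>

lemma AE_measure_supp:
  assumes "\<mu> = gaussian_measure \<or> \<mu> = (exponential_measure :: (real ^ 'n::finite) measure)"
  shows "AE x in \<mu>. x \<in> measure_supp \<mu>"
  using assms
proof
  assume \<mu>: "\<mu> = exponential_measure"
  show ?thesis
    unfolding \<mu> measure_supp_exponential unfolding exponential_measure_eq_density
    using exponential_density_measurable
    by (subst AE_density) (auto simp: indicator_def)
qed (simp add: measure_supp_gaussian)

section \<open>Splitting integrals along the pieces of the complement\<close>

text \<open>Almost every point lies in exactly one of \<open>\<Omega>\<close>, \<open>A 1\<close>,
  ..., \<open>A s\<close>, so the indicators of these sets add up to 1 almost everywhere.\<close>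

lemma partition_set_integral:
  fixes h :: "real ^ 'n::finite \<Rightarrow> real" and s :: nat
  assumes h: "integrable \<mu> h"
    and \<Omega>: "\<Omega> \<in> sets \<mu>" "\<And>l. l \<in> {1..s} \<Longrightarrow> A l \<in> sets \<mu>"
    and supp: "AE x in \<mu>. x \<in> S"
    and cover: "((S - \<Omega>) - (\<Union>l\<in>{1..s}. A l)) \<union> ((\<Union>l\<in>{1..s}. A l) - (S - \<Omega>)) \<in> null_sets \<mu>"
    and overlap: "\<And>k l. k \<in> {1..s} \<Longrightarrow> l \<in> {1..s} \<Longrightarrow> k \<noteq> l \<Longrightarrow> A k \<inter> A l \<in> null_sets \<mu>"
  shows "(LINT x|\<mu>. h x) - (\<Sum>l=1..s. LINT x:A l|\<mu>. h x) = (LINT x:\<Omega>|\<mu>. h x)"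
proof -
  \<comment> \<open>Making the case \<open>k = l\<close> trivially true allows a finite intersection
    over all pairs.\<close>
  have "AE x in \<mu>. k \<noteq> l \<longrightarrow> x \<notin> A k \<inter> A l" if "k \<in> {1..s}" "l \<in> {1..s}" for k l
    using AE_not_in[OF overlap[OF that]] by (cases "k = l") auto
  then have "AE x in \<mu>. \<forall>k\<in>{1..s}. \<forall>l\<in>{1..s}. k \<noteq> l \<longrightarrow> x \<notin> A k \<inter> A l"
    by (intro AE_finite_allI) auto
  moreover note AE_not_in[OF cover] supp
  ultimately have ae: "AE x in \<mu>. indicator \<Omega> x * h x + (\<Sum>l=1..s. indicator (A l) x * h x) = h x"
  proof eventually_elim
    case (elim x)
    show ?case
    proof (cases "x \<in> \<Omega>")
      case True
      then have "x \<notin> A l" if "l \<in> {1..s}" for l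
        using elim that by blast
      then show ?thesis
        using True by simp
    next
      case False
      then obtain k where k: "k \<in> {1..s}" "x \<in> A k"
        using elim by blast
      then have "(\<Sum>l=1..s. indicator (A l) x * h x) = (\<Sum>l=1..s. if l = k then h x else 0)"
        using elim by (intro sum.cong) (auto simp: indicator_def)
      then show ?thesis
        using False k by simp
    qed
  qed
  have i: "integrable \<mu> (\<lambda>x. indicator B x * h x)" if "B \<in> sets \<mu>" for B
    using integrable_mult_indicator[OF that h] by simp
  have "(LINT x|\<mu>. h x) = (LINT x|\<mu>. indicator \<Omega> x * h x + (\<Sum>l=1..s. indicator (A l) x * h x))"
  proof (rule integral_cong_AE)
    show "h \<in> borel_measurable \<mu>" using h by simp
    show "(\<lambda>x. indicator \<Omega> x * h x + (\<Sum>l=1..s. indicator (A l) x * h x)) \<in> borel_measurable \<mu>"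
      using i \<Omega> by (intro borel_measurable_integrable Bochner_Integration.integrable_add
        Bochner_Integration.integrable_sum) auto
    show "AE x in \<mu>. h x = indicator \<Omega> x * h x + (\<Sum>l=1..s. indicator (A l) x * h x)"
      using ae by eventually_elim simp
  qed
  also have "\<dots> = (LINT x:\<Omega>|\<mu>. h x) + (\<Sum>l=1..s. LINT x:A l|\<mu>. h x)"
    unfolding set_lebesgue_integral_def real_scaleR_def using i \<Omega>
    by (subst Bochner_Integration.integral_add, blast, intro Bochner_Integration.integrable_sum, blast)
      (subst Bochner_Integration.integral_sum, auto)
  finally show ?thesis by simp
qed

section \<open>Bounds and limits for volumes and for integrals of squares\<close>

theorem corollary2p6:
  fixes \<mu> :: "(real ^ 'n::finite) measure"
    and m s d0 :: nat
    and g :: "nat \<Rightarrow> 'n rpoly"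
    and mc :: "nat \<Rightarrow> nat"
    and gc :: "nat \<Rightarrow> nat \<Rightarrow> 'n rpoly"
    and \<Omega> \<Omega>c :: "(real ^ 'n) set"
    and \<Omega>cl :: "nat \<Rightarrow> (real ^ 'n) set"
  assumes mu: "\<mu> = gaussian_measure \<or> \<mu> = exponential_measure"
    and Omega: "\<Omega> = semialg (g ` {1..m})"
    and orthant: "\<mu> = exponential_measure \<Longrightarrow> \<forall>i. \<exists>j\<in>{1..m}. g j = poly_var i"
    and Omega_c: "\<Omega>c = measure_supp \<mu> - \<Omega>"
    and Omega_cl: "\<And>l. l \<in> {1..s} \<Longrightarrow> \<Omega>cl l = semialg (gc l ` {1..mc l})"
    and Omega_cl_subset: "\<And>l. l \<in> {1..s} \<Longrightarrow> \<Omega>cl l \<subseteq> measure_supp \<mu>"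
    and cover: "(\<Omega>c - (\<Union>l\<in>{1..s}. \<Omega>cl l)) \<union> ((\<Union>l\<in>{1..s}. \<Omega>cl l) - \<Omega>c) \<in> null_sets \<mu>"
    and overlap: "\<And>k l. k \<in> {1..s} \<Longrightarrow> l \<in> {1..s} \<Longrightarrow> k \<noteq> l \<Longrightarrow> \<Omega>cl k \<inter> \<Omega>cl l \<in> null_sets \<mu>"
    and d0: "d0 = Max (insert 0 (half_deg ` (g ` {1..m} \<union> (\<Union>l\<in>{1..s}. gc l ` {1..mc l}))))"
  shows
    "((\<forall>d\<ge>d0.
         ereal (measure \<mu> UNIV) - (\<Sum>l=1..s. sdp_sup \<mu> d 1 (gc l ` {1..mc l}))
           \<le> ereal (measure \<mu> \<Omega>) \<and>
         ereal (measure \<mu> \<Omega>) \<le> sdp_sup \<mu> d 1 (g ` {1..m})) \<and>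
      (\<lambda>d. ereal (measure \<mu> UNIV) - (\<Sum>l=1..s. sdp_sup \<mu> d 1 (gc l ` {1..mc l})))
        \<longlonglongrightarrow> ereal (measure \<mu> \<Omega>) \<and>
      (\<lambda>d. sdp_sup \<mu> d 1 (g ` {1..m})) \<longlonglongrightarrow> ereal (measure \<mu> \<Omega>))
     \<and>
     (\<forall>f :: 'n rpoly. (\<forall>x\<in>frontier \<Omega>. poly_eval f x = 0) \<longrightarrow>
       (\<forall>d\<ge>d0. poly_deg f \<le> d \<longrightarrow>
         ereal (LINT x|\<mu>. (poly_eval f x)\<^sup>2) - (\<Sum>l=1..s. sdp_sup \<mu> d (f\<^sup>2) (gc l ` {1..mc l}))
           \<le> ereal (LINT x:\<Omega>|\<mu>. (poly_eval f x)\<^sup>2) \<and>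
         ereal (LINT x:\<Omega>|\<mu>. (poly_eval f x)\<^sup>2) \<le> sdp_sup \<mu> d (f\<^sup>2) (g ` {1..m})) \<and>
       (\<lambda>d. ereal (LINT x|\<mu>. (poly_eval f x)\<^sup>2) - (\<Sum>l=1..s. sdp_sup \<mu> d (f\<^sup>2) (gc l ` {1..mc l})))
         \<longlonglongrightarrow> ereal (LINT x:\<Omega>|\<mu>. (poly_eval f x)\<^sup>2) \<and>
       (\<lambda>d. sdp_sup \<mu> d (f\<^sup>2) (g ` {1..m})) \<longlonglongrightarrow> ereal (LINT x:\<Omega>|\<mu>. (poly_eval f x)\<^sup>2))"
proof -
  have "exp_moments \<mu> (1/2)"
    using mu exp_moments_gaussian exp_moments_exponential by blast
  then interpret exp_moments \<mu> "1/2" .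
  let ?G = "g ` {1..m}" and ?Gc = "\<lambda>l. gc l ` {1..mc l}"
  have sets_semialg: "semialg G \<in> sets \<mu>" for G
    using closed_semialg[of G] by (auto simp: sets_mu intro: borel_closed)
  have split: "(LINT x|\<mu>. (poly_eval f x)\<^sup>2) - (\<Sum>l=1..s. LINT x:semialg (?Gc l)|\<mu>. (poly_eval f x)\<^sup>2)
      = (LINT x:\<Omega>|\<mu>. (poly_eval f x)\<^sup>2)" for f
  proof -
    have "(LINT x|\<mu>. (poly_eval f x)\<^sup>2) - (\<Sum>l=1..s. LINT x:\<Omega>cl l|\<mu>. (poly_eval f x)\<^sup>2)
        = (LINT x:\<Omega>|\<mu>. (poly_eval f x)\<^sup>2)"
    proof (rule partition_set_integral)
      show "integrable \<mu> (\<lambda>x. (poly_eval f x)\<^sup>2)"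
        by (intro subexp_integrable subexp_intros)
      show "AE x in \<mu>. x \<in> measure_supp \<mu>"
        using mu by (rule AE_measure_supp)
    qed (use Omega Omega_cl sets_semialg cover[unfolded Omega_c] overlap in auto)
    then show ?thesis
      using Omega_cl by simp
  qed
  have upper: "ereal (LINT x:\<Omega>|\<mu>. (poly_eval f x)\<^sup>2) \<le> sdp_sup \<mu> d (f\<^sup>2) ?G" for f d
    unfolding Omega by (rule sdp_sup_ge)
  have lower: "ereal (LINT x|\<mu>. (poly_eval f x)\<^sup>2) - (\<Sum>l=1..s. sdp_sup \<mu> d (f\<^sup>2) (?Gc l))
      \<le> ereal (LINT x:\<Omega>|\<mu>. (poly_eval f x)\<^sup>2)" for f d
  proof -
    have "(\<Sum>l=1..s. ereal (LINT x:semialg (?Gc l)|\<mu>. (poly_eval f x)\<^sup>2))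
        \<le> (\<Sum>l=1..s. sdp_sup \<mu> d (f\<^sup>2) (?Gc l))"
      by (intro sum_mono sdp_sup_ge)
    then have "ereal (LINT x|\<mu>. (poly_eval f x)\<^sup>2) - (\<Sum>l=1..s. sdp_sup \<mu> d (f\<^sup>2) (?Gc l))
        \<le> ereal (LINT x|\<mu>. (poly_eval f x)\<^sup>2)
          - (\<Sum>l=1..s. ereal (LINT x:semialg (?Gc l)|\<mu>. (poly_eval f x)\<^sup>2))"
      by (intro ereal_minus_mono order_refl)
    then show ?thesis
      by (simp flip: split)
  qed
  have upper_lim: "(\<lambda>d. sdp_sup \<mu> d (f\<^sup>2) ?G) \<longlonglongrightarrow> ereal (LINT x:\<Omega>|\<mu>. (poly_eval f x)\<^sup>2)" for f
    unfolding Omega by (rule sdp_sup_tendsto) simp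
  have lower_lim: "(\<lambda>d. ereal (LINT x|\<mu>. (poly_eval f x)\<^sup>2) - (\<Sum>l=1..s. sdp_sup \<mu> d (f\<^sup>2) (?Gc l)))
      \<longlonglongrightarrow> ereal (LINT x:\<Omega>|\<mu>. (poly_eval f x)\<^sup>2)" for f
  proof -
    \<comment> \<open>All limits involved are real, so no difference of infinities arises in the
      extended reals.\<close>
    have "(\<lambda>d. ereal (LINT x|\<mu>. (poly_eval f x)\<^sup>2) - (\<Sum>l=1..s. sdp_sup \<mu> d (f\<^sup>2) (?Gc l)))
        \<longlonglongrightarrow> ereal (LINT x|\<mu>. (poly_eval f x)\<^sup>2)
          - (\<Sum>l=1..s. ereal (LINT x:semialg (?Gc l)|\<mu>. (poly_eval f x)\<^sup>2))"
      by (intro tendsto_diff_ereal_general tendsto_const tendsto_sum_ereal sdp_sup_tendsto) auto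
    then show ?thesis
      by (simp flip: split)
  qed
  \<comment> \<open>The choice \<open>f = 1\<close> turns the integrals into measures and yields the
    claims on volumes.\<close>
  have total: "(LINT x|\<mu>. (poly_eval 1 x)\<^sup>2) = measure \<mu> UNIV"
    by (simp add: space_mu)
  have measure_Omega: "(LINT x:\<Omega>|\<mu>. (poly_eval 1 x)\<^sup>2) = measure \<mu> \<Omega>"
    using sets_semialg by (simp add: Omega set_lebesgue_integral_def space_mu)
  show ?thesis
    using upper[of 1] lower[of 1] upper_lim[of 1] lower_lim[of 1] upper lower upper_lim lower_lim
    unfolding total measure_Omega by simp
qed

end
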